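(* Let $b>1$ be an integer, and assume that number representations are written in base $b$ with the least significant digit first. Given as input a minimal deterministic finite automaton $\mathcal{A}$ over the alphabet $\{0,1,\ldots,b-1\}$ with $n$ states, it is decidable in time $O(b\,n)$ whether $\mathcal{A}$ accepts an ultimately periodic set of nonnegative integers.
   Context: For a word $u=a_0a_1\cdots a_m$ over $A_b=\{0,1,\ldots,b-1\}$, its value (least significant digit first) is $\overline{u}=\sum_{i=0}^{m}a_i b^i$; the empty word has value $0$. An automaton $\mathcal{A}$ over $A_b$ accepts the set $S\subseteq\mathbb{N}$ if the language of $\mathcal{A}$ is exactly $\{u\in A_b^*\mid \overline{u}\in S\}$ (acceptance by value: either all words with a given value are accepted, or none of them). A set $S\subseteq\mathbb{N}$ is ultimately periodic if there are a finite set $I\subseteq\mathbb{N}$, a positive integer $p$ and $R\subseteq\{0,\ldots,p-1\}$ such that $S$ is the symmetric difference of $I$ and $R+p\mathbb{N}$. A minimal automaton is the complete deterministic automaton with the least number of states accepting its language. Time is measured in the usual sense (unit-cost RAM), uniformly in $b$ and $n$. *)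

theory Defs
  imports Main
begin

definition word_value :: "nat \<Rightarrow> nat list \<Rightarrow> nat" where
  "word_value b u = (\<Sum>i<length u. u ! i * b ^ i)"

definition ultimately_periodic :: "nat set \<Rightarrow> bool" where
  "ultimately_periodic S \<longleftrightarrow>
    (\<exists>I p R. finite I \<and> p > 0 \<and> R \<subseteq> {..<p} \<and> S = sym_diff I {r + p * k | r k. r \<in> R})"


text \<open>
  Complete deterministic automata over the alphabet \<open>{..<b}\<close> whose state set is \<open>{..<n}\<close>.
  Numbering the states loses no generality, and it is the form in which an automaton can be
  handed to a machine. The values of \<open>delta\<close> outside \<open>{..<n}\<close> and \<open>{..<b}\<close> are irrelevant.
\<close>

record dfa =
  init :: nat
  delta :: "nat \<Rightarrow> nat \<Rightarrow> nat"
  finals :: "nat set"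

definition is_dfa :: "nat \<Rightarrow> nat \<Rightarrow> dfa \<Rightarrow> bool" where
  "is_dfa b n A \<longleftrightarrow>
    init A < n \<and> (\<forall>q<n. \<forall>a<b. delta A q a < n) \<and> finals A \<subseteq> {..<n}"

definition lang :: "nat \<Rightarrow> dfa \<Rightarrow> nat list set" where
  "lang b A = {u \<in> lists {..<b}. foldl (delta A) (init A) u \<in> finals A}"

definition minimal_dfa :: "nat \<Rightarrow> nat \<Rightarrow> dfa \<Rightarrow> bool" where
  "minimal_dfa b n A \<longleftrightarrow>
    is_dfa b n A \<and> (\<forall>m B. is_dfa b m B \<and> lang b B = lang b A \<longrightarrow> n \<le> m)"

definition accepts_set :: "nat \<Rightarrow> dfa \<Rightarrow> nat set \<Rightarrow> bool" where
  "accepts_set b A S \<longleftrightarrow> lang b A = {u \<in> lists {..<b}. word_value b u \<in> S}"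


text \<open>
  The random access machine of Cook and Reckhow with the unit-cost measure: every instruction
  takes one time step. The registers \<open>X 0, X 1, \<dots>\<close> hold natural numbers, so subtraction is
  truncated. There is deliberately no multiplication or division: with these at unit cost on
  unbounded registers the machine would be unreasonably powerful.
\<close>

datatype instr =
    Const nat nat     \<comment> \<open>\<open>Const i c\<close>: \<open>X i := c\<close>\<close>
  | Add nat nat nat   \<comment> \<open>\<open>Add i j k\<close>: \<open>X i := X j + X k\<close>\<close>
  | Sub nat nat nat   \<comment> \<open>\<open>Sub i j k\<close>: \<open>X i := X j - X k\<close>\<close>
  | Load nat nat      \<comment> \<open>\<open>Load i j\<close>: \<open>X i := X (X j)\<close>\<close>
  | Store nat nat     \<comment> \<open>\<open>Store i j\<close>: \<open>X (X i) := X j\<close>\<close>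
  | Read nat          \<comment> \<open>\<open>Read i\<close>: \<open>X i :=\<close> next input number (\<open>0\<close> once the input is exhausted)\<close>
  | Jump nat nat      \<comment> \<open>\<open>Jump j m\<close>: go to instruction \<open>m\<close> if \<open>X j > 0\<close>\<close>
  | Halt bool         \<comment> \<open>stop with the given yes/no answer\<close>

type_synonym config = "nat \<times> (nat \<Rightarrow> nat) \<times> nat list"  \<comment> \<open>program counter, registers, unread input\<close>

fun exec :: "instr \<Rightarrow> config \<Rightarrow> config" where
  "exec (Const i c) (pc, X, inp) = (Suc pc, X(i := c), inp)"
| "exec (Add i j k) (pc, X, inp) = (Suc pc, X(i := X j + X k), inp)"
| "exec (Sub i j k) (pc, X, inp) = (Suc pc, X(i := X j - X k), inp)"
| "exec (Load i j) (pc, X, inp) = (Suc pc, X(i := X (X j)), inp)"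
| "exec (Store i j) (pc, X, inp) = (Suc pc, X(X i := X j), inp)"
| "exec (Read i) (pc, X, inp) = (Suc pc, X(i := (if inp = [] then 0 else hd inp)), tl inp)"
| "exec (Jump j m) (pc, X, inp) = ((if X j > 0 then m else Suc pc), X, inp)"
| "exec (Halt ans) (pc, X, inp) = (pc, X, inp)"

text \<open>A machine whose program counter leaves the program is stuck and gives no answer.\<close>

definition step :: "instr list \<Rightarrow> config \<Rightarrow> config" where
  "step P c = (if fst c < length P then exec (P ! fst c) c else c)"

definition answers_within :: "instr list \<Rightarrow> nat list \<Rightarrow> nat \<Rightarrow> bool \<Rightarrow> bool" where
  "answers_within P inp t ans \<longleftrightarrow>
    (\<exists>k\<le>t. let pc = fst ((step P ^^ k) (0, \<lambda>_. 0, inp))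
           in pc < length P \<and> P ! pc = Halt ans)"

text \<open>The input is \<open>b\<close>, \<open>n\<close>, the initial state, the transition table row by row (one row per
  state), and one bit per state telling whether it is final.\<close>

definition encode :: "nat \<Rightarrow> nat \<Rightarrow> dfa \<Rightarrow> nat list" where
  "encode b n A =
    [b, n, init A] @ [delta A q a. q \<leftarrow> [0..<n], a \<leftarrow> [0..<b]]
      @ [if q \<in> finals A then 1 else 0. q \<leftarrow> [0..<n]]"

end

theory Submission imports Defs begin

text \<open>
  Write \<open>S\<^sub>q\<close> for the set of values accepted from the state \<open>q\<close>. Let \<open>D\<close> be the set of states left
  after repeatedly removing states of in-degree zero; every state of \<open>D\<close> is reached by arbitrarily
  long words. If the accepted set is ultimately periodic, there is therefore one period, coprime to
  \<open>b\<close>, that is valid on \<open>S\<^sub>q - {0}\<close> for all \<open>q \<in> D\<close>. Coprimality makes the digit \<open>0\<close> act injectively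
  on \<open>D\<close>, and the inverse of this action applied after the digit \<open>1\<close> is a map \<open>g\<close> on \<open>D\<close> that
  realises the shift \<open>S\<^sub>q \<mapsto> {k. k + 1 \<in> S\<^sub>q}\<close>. By minimality \<open>g\<close> satisfies the equations
  \<open>\<delta> (g q) a = \<delta> q (a + 1)\<close> for \<open>a + 1 < b\<close> and \<open>\<delta> (g q) (b - 1) = g (\<delta> q 0)\<close>. Conversely,
  these equations force \<open>k \<in> S\<^sub>q\<close> to depend only on \<open>g\<^sup>k q\<close>, whose sequence is ultimately periodic
  because \<open>D\<close> is finite; the removed states inherit ultimate periodicity from their successors.
  All of this is checked with a constant number of operations per transition.
\<close>

section \<open>Ultimately periodic sets\<close>

definition eventually_periodic :: "nat set \<Rightarrow> bool" where
  "eventually_periodic S \<longleftrightarrow> (\<exists>N p. p > 0 \<and> (\<forall>k\<ge>N. k + p \<in> S \<longleftrightarrow> k \<in> S))"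

lemma period_mult:
  fixes S :: "nat set"
  assumes "\<And>k. k \<ge> N \<Longrightarrow> k + p \<in> S \<longleftrightarrow> k \<in> S" and "k \<ge> N"
  shows "k + j * p \<in> S \<longleftrightarrow> k \<in> S"
proof (induction j)
  case (Suc j)
  then show ?case using assms(1)[of "k + j * p"] assms(2) by (simp add: algebra_simps)
qed simp

text \<open>A union of residue classes modulo \<open>p\<close> has period \<open>p\<close>
  everywhere, and beyond a bound on \<open>I\<close> the symmetric difference changes nothing.
  Conversely, \<open>R\<close> collects the residues of late members, and \<open>I\<close> is the
  difference to the resulting classes, all below the threshold.\<close>

lemma ultimately_periodic_iff: "ultimately_periodic S \<longleftrightarrow> eventually_periodic S"
proof
  assume "ultimately_periodic S"
  then obtain I p R where *: "finite I" "p > 0" "R \<subseteq> {..<p}" "S = sym_diff I {r + p * k | r k. r \<in> R}"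
    by (auto simp: ultimately_periodic_def)
  have R: "{r + p * k | r k. r \<in> R} = {k. k mod p \<in> R}"
  proof (intro set_eqI iffI)
    fix x assume "x \<in> {k. k mod p \<in> R}"
    then show "x \<in> {r + p * k | r k. r \<in> R}"
      by (intro CollectI exI[of _ "x mod p"] exI[of _ "x div p"]) simp
  qed (use *(3) in \<open>auto simp: subset_iff\<close>)
  obtain N where "I \<subseteq> {..<N}" using *(1) by (auto simp: finite_nat_set_iff_bounded)
  then have "\<forall>k\<ge>N. k \<notin> I \<and> k + p \<notin> I" by (auto simp: subset_iff)
  then have "\<forall>k\<ge>N. k + p \<in> S \<longleftrightarrow> k \<in> S" unfolding *(4) R by auto
  then show "eventually_periodic S" using *(2) by (auto simp: eventually_periodic_def)
next
  assume "eventually_periodic S"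
  then obtain N p where *: "p > 0" "\<And>k. k \<ge> N \<Longrightarrow> k + p \<in> S \<longleftrightarrow> k \<in> S"
    by (auto simp: eventually_periodic_def)
  define R where "R = {k mod p | k. k \<ge> N \<and> k \<in> S}"
  define T where "T = {r + p * k | r k. r \<in> R}"
  have T: "x \<in> T \<longleftrightarrow> x \<in> S" if "x \<ge> N" for x
  proof
    assume "x \<in> T"
    then obtain k j where k: "k \<ge> N" "k \<in> S" "x = k mod p + p * j" by (auto simp: T_def R_def)
    then have "x mod p = k mod p" by simp
    \<comment> \<open>Congruent numbers become equal after adding multiples of \<open>p\<close> to
      both, which avoids a case distinction on their order.\<close>
    then obtain i j where "x + i * p = k + j * p"
      using nat_mod_eq_iff[of x p k] by (auto simp: mult.commute)
    then show "x \<in> S" using period_mult[OF *(2)] k that by metis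
  next
    assume "x \<in> S"
    then have "x mod p \<in> R" using that by (auto simp: R_def)
    then show "x \<in> T" unfolding T_def by (intro CollectI exI[of _ "x mod p"] exI[of _ "x div p"]) simp
  qed
  have "sym_diff S T \<subseteq> {..<N}" using T by (auto simp: not_less[symmetric])
  then have "finite (sym_diff S T)" by (rule finite_subset) simp
  moreover have "R \<subseteq> {..<p}" using *(1) by (auto simp: R_def)
  moreover have "S = sym_diff (sym_diff S T) T" by auto
  ultimately show "ultimately_periodic S"
    unfolding ultimately_periodic_def T_def using *(1) by blast
qed

text \<open>Pigeonhole: an orbit inside a finite set visits a point twice, at \<open>i < j\<close>,
  and from \<open>i\<close> on it cycles with period \<open>j - i\<close>.\<close>

lemma eventually_periodic_orbit:
  fixes g :: "'a \<Rightarrow> 'a"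
  assumes "finite D" "q \<in> D" "\<And>x. x \<in> D \<Longrightarrow> g x \<in> D"
  shows "eventually_periodic {k. (g ^^ k) q \<in> F}"
proof -
  have "(g ^^ k) q \<in> D" for k using assms(2,3) by (induction k) auto
  then have "range (\<lambda>k. (g ^^ k) q) \<subseteq> D" by auto
  then have "finite (range (\<lambda>k. (g ^^ k) q))" using assms(1) finite_subset by blast
  then have "\<not> inj (\<lambda>k. (g ^^ k) q)" using finite_imageD by blast
  then obtain i j where "(g ^^ i) q = (g ^^ j) q" "i \<noteq> j" by (auto simp: inj_def)
  then obtain i j where ij: "(g ^^ i) q = (g ^^ j) q" "i < j" by (metis nat_neq_iff)
  have "(g ^^ (k + (j - i))) q = (g ^^ k) q" if "k \<ge> i" for k
  proof -
    have "k + (j - i) = (k - i) + j" "k = (k - i) + i" using that ij(2) by auto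
    then show ?thesis using ij(1) by (metis comp_apply funpow_add)
  qed
  then show ?thesis unfolding eventually_periodic_def
    using ij(2) by (intro exI[of _ i] exI[of _ "j - i"]) auto
qed

text \<open>Finitely many sections share a threshold \<open>N\<close> and a period \<open>p\<close>.
  Adding \<open>b * p\<close> keeps the last digit and adds \<open>p\<close> to the quotient, so
  \<open>b * N\<close> and \<open>b * p\<close> serve for \<open>T\<close>.\<close>

lemma eventually_periodic_digits:
  assumes b: "b > (0::nat)" and per: "\<And>a. a < b \<Longrightarrow> eventually_periodic (S a)"
    and T: "\<And>k. k \<in> T \<longleftrightarrow> k div b \<in> S (k mod b)"
  shows "eventually_periodic T"
proof -
  \<comment> \<open>Digits are added one at a time, taking the maximum of the thresholds and the
    product of the periods.\<close>
  have "m \<le> b \<Longrightarrow> \<exists>N p. p > 0 \<and> (\<forall>a<m. \<forall>k\<ge>N. k + p \<in> S a \<longleftrightarrow> k \<in> S a)" for m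
  proof (induction m)
    case (Suc m)
    then obtain N p where 1: "p > 0" "\<forall>a<m. \<forall>k\<ge>N. k + p \<in> S a \<longleftrightarrow> k \<in> S a" by auto
    obtain N' p' where 2: "p' > 0" "\<forall>k\<ge>N'. k + p' \<in> S m \<longleftrightarrow> k \<in> S m"
      using per[of m] Suc.prems by (auto simp: eventually_periodic_def)
    show ?case
    proof (intro exI conjI allI impI)
      show "p * p' > 0" using 1 2 by simp
      fix a k assume a: "a < Suc m" and k: "k \<ge> max N N'"
      show "k + p * p' \<in> S a \<longleftrightarrow> k \<in> S a"
      proof (cases "a = m")
        case True
        then show ?thesis using period_mult[of N' p' "S m" k p] 2 k by auto
      next
        case False
        then show ?thesis using period_mult[of N p "S a" k p'] 1 k a by (auto simp: mult.commute)
      qed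
    qed
  qed (auto intro: exI[of _ 1])
  then obtain N p where *: "p > 0" "\<And>a k. a < b \<Longrightarrow> k \<ge> N \<Longrightarrow> k + p \<in> S a \<longleftrightarrow> k \<in> S a"
    by (meson order_refl)
  have "k + b * p \<in> T \<longleftrightarrow> k \<in> T" if "k \<ge> b * N" for k
  proof -
    have "k div b \<ge> N" using div_le_mono[OF that, of b] b by simp
    then show ?thesis using *(2)[of "k mod b" "k div b"] b by (simp add: T add.commute)
  qed
  then show ?thesis unfolding eventually_periodic_def using *(1) b by (intro exI[of _ "b * N"] exI[of _ "b * p"]) auto
qed

text \<open>Repeatedly dividing \<open>p\<close> by its gcd with \<open>b\<close> ends in a part
  coprime to \<open>b\<close>; each removed factor divides one copy of \<open>b\<close>.\<close>

lemma dvd_power_times_coprime: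
  fixes p b :: nat
  assumes "p > 0"
  shows "\<exists>m p'. p' > 0 \<and> coprime p' b \<and> p dvd b ^ m * p'"
  using assms
proof (induction p rule: less_induct)
  case (less p)
  show ?case
  proof (cases "coprime p b")
    case True
    then show ?thesis using less.prems by (intro exI[of _ 0] exI[of _ p]) auto
  next
    case False
    define c where "c = gcd p b"
    have "c \<noteq> 1" "c \<noteq> 0" using False less.prems unfolding c_def
      by (metis coprime_iff_gcd_eq_1, simp)
    then have c: "c > 1" "c dvd p" "c dvd b" by linarith (simp_all add: c_def)
    then obtain p1 where p1: "p = c * p1" by auto
    then have "p1 < p" "p1 > 0" using less.prems c by auto
    then obtain m p' where "p' > 0" "coprime p' b" "p1 dvd b ^ m * p'" using less.IH by blast
    then show ?thesis using c p1
      by (intro exI[of _ "Suc m"] exI[of _ p']) (auto simp: mult.assoc intro: mult_dvd_mono)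
  qed
qed

section \<open>Minimal automata\<close>

definition run_lang :: "nat \<Rightarrow> dfa \<Rightarrow> nat \<Rightarrow> nat list set" where
  "run_lang b A q = {u \<in> lists {..<b}. foldl (delta A) q u \<in> finals A}"

lemma foldl_delta_less:
  assumes "is_dfa b n A" "q < n" "u \<in> lists {..<b}"
  shows "foldl (delta A) q u < n"
  using assms(2,3) by (induction u arbitrary: q) (use assms(1) in \<open>auto simp: is_dfa_def\<close>)

text \<open>Merging reachable states with equal right languages gives an equivalent automaton
  \<open>B\<close> with \<open>card ?K\<close> states. Minimality forces
  \<open>n \<le> card ?K \<le> card Q \<le> n\<close>, so equality holds throughout.\<close>

lemma minimal_dfa_reachable_inj:
  assumes "minimal_dfa b n A"
  defines "Q \<equiv> {foldl (delta A) (init A) u | u. u \<in> lists {..<b}}"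
  shows "Q = {..<n}" and "inj_on (run_lang b A) {..<n}"
proof -
  have dfa: "is_dfa b n A" using assms by (simp add: minimal_dfa_def)
  then have "Q \<subseteq> {..<n}" using foldl_delta_less[OF dfa] by (auto simp: Q_def is_dfa_def)
  then have fin: "finite Q" by (rule finite_subset) simp
  have init: "init A \<in> Q" unfolding Q_def by (rule CollectI, rule exI[of _ "[]"]) simp
  have closed: "delta A q a \<in> Q" if q: "q \<in> Q" and a: "a < b" for q a
  proof -
    obtain u where "u \<in> lists {..<b}" "q = foldl (delta A) (init A) u" using q by (auto simp: Q_def)
    then show ?thesis using a unfolding Q_def by (intro CollectI exI[of _ "u @ [a]"]) auto
  qed
  let ?K = "run_lang b A ` Q"
  \<comment> \<open>The states of an automaton are an initial segment of the naturals, so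
    \<open>f\<close> numbers the right languages; \<open>g\<close> picks a reachable representative
    of each number.\<close>
  obtain f where f: "bij_betw f ?K {..<card ?K}"
    using ex_bij_betw_finite_nat[of ?K] fin by (auto simp: atLeast0LessThan)
  define g where "g i = (SOME q. q \<in> Q \<and> f (run_lang b A q) = i)" for i
  have g: "g i \<in> Q \<and> f (run_lang b A (g i)) = i" if "i < card ?K" for i
  proof -
    have "\<exists>q. q \<in> Q \<and> f (run_lang b A q) = i"
      using f that by (auto simp: bij_betw_def) (metis imageE lessThan_iff)
    then show ?thesis unfolding g_def by (rule someI_ex)
  qed
  let ?e = "\<lambda>q. f (run_lang b A q)"
  have e: "?e q < card ?K" if "q \<in> Q" for q using f that by (auto simp: bij_betw_def)
  have lang_eq: "run_lang b A (g (?e q)) = run_lang b A q" if "q \<in> Q" for q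
    using g[OF e[OF that]] f that by (auto simp: bij_betw_def inj_on_def)
  define B where "B = \<lparr>init = ?e (init A), delta = (\<lambda>i a. ?e (delta A (g i) a)),
    finals = {i. i < card ?K \<and> g i \<in> finals A}\<rparr>"
  have B: "is_dfa b (card ?K) B"
    using e init g closed by (auto simp: B_def is_dfa_def)
  have run_lang_Cons: "a # u \<in> run_lang b A q \<longleftrightarrow> a < b \<and> u \<in> run_lang b A (delta A q a)" for a u q
    by (auto simp: run_lang_def)
  \<comment> \<open>The representative \<open>g (?e q)\<close> may differ from \<open>q\<close>, but
    it has the same right language, which carries the induction through each letter.\<close>
  have "q \<in> Q \<Longrightarrow> u \<in> lists {..<b} \<Longrightarrow> foldl (delta B) (?e q) u \<in> finals B \<longleftrightarrow> u \<in> run_lang b A q" for q u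
  proof (induction u arbitrary: q)
    case Nil
    have "g (?e q) \<in> finals A \<longleftrightarrow> [] \<in> run_lang b A (g (?e q))" by (simp add: run_lang_def)
    then show ?case using lang_eq[OF Nil(1)] e[OF Nil(1)] by (simp add: B_def)
  next
    case (Cons a u)
    let ?q = "delta A (g (?e q)) a"
    have "?q \<in> Q" using closed g[OF e[OF Cons.prems(1)]] Cons.prems(2) by auto
    then have "foldl (delta B) (?e ?q) u \<in> finals B \<longleftrightarrow> a # u \<in> run_lang b A (g (?e q))"
      using Cons by (auto simp: run_lang_Cons)
    moreover have "foldl (delta B) (?e q) (a # u) = foldl (delta B) (?e ?q) u"
      by (simp add: B_def)
    ultimately show ?case using lang_eq[OF Cons.prems(1)] by simp
  qed
  from this[OF init] have "lang b B = lang b A"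
    by (auto simp: lang_def run_lang_def B_def)
  then have "n \<le> card ?K" using assms(1) B by (auto simp: minimal_dfa_def)
  moreover have "card ?K \<le> card Q" using fin by (rule card_image_le)
  moreover have "card Q \<le> n" using card_mono[OF _ \<open>Q \<subseteq> {..<n}\<close>] by simp
  ultimately have eq: "card ?K = card Q" "card Q = n" by simp_all
  then show "Q = {..<n}" using \<open>Q \<subseteq> {..<n}\<close> by (simp add: card_subset_eq)
  then show "inj_on (run_lang b A) {..<n}" using eq(1) fin eq_card_imp_inj_on by metis
qed

lemma word_value_Nil [simp]: "word_value b [] = 0"
  by (simp add: word_value_def)

lemma word_value_Cons [simp]: "word_value b (a # u) = a + b * word_value b u"
  by (simp add: word_value_def lessThan_Suc_eq_insert_0 zero_notin_Suc_image sum.reindex sum_distrib_left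
      mult.left_commute)

section \<open>Sets of values accepted from a state\<close>

text \<open>The canonical representation, without trailing zeros; the guard on \<open>b\<close>
  ensures termination.\<close>

function digits :: "nat \<Rightarrow> nat \<Rightarrow> nat list" where
  "digits b k = (if b \<le> 1 \<or> k = 0 then [] else k mod b # digits b (k div b))"
  by auto
termination by (relation "measure snd") auto

declare digits.simps [simp del]

lemma digits_in_lists: "b > 1 \<Longrightarrow> digits b k \<in> lists {..<b}"
  by (induction b k rule: digits.induct) (subst digits.simps, auto)

lemma word_value_digits: "b > 1 \<Longrightarrow> word_value b (digits b k) = k"
  by (induction b k rule: digits.induct) (subst digits.simps, auto)

text \<open>Only the canonical word is tested; under the assumption \<open>zero\<close> of
  \<open>value_dfa\<close> this agrees with every other word of the same value.\<close>

definition value_set :: "nat \<Rightarrow> dfa \<Rightarrow> nat \<Rightarrow> nat set" where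
  "value_set b A q = {k. foldl (delta A) q (digits b k) \<in> finals A}"

text \<open>Words with the same value differ only by trailing zeros, so \<open>zero\<close>
  expresses state by state that acceptance depends on the value alone.\<close>

locale value_dfa =
  fixes b n :: nat and A :: dfa
  assumes base: "b > 1" and dfa: "is_dfa b n A"
    and zero: "\<And>q. q < n \<Longrightarrow> delta A q 0 \<in> finals A \<longleftrightarrow> q \<in> finals A"
begin

lemma delta_less [simp]: "q < n \<Longrightarrow> a < b \<Longrightarrow> delta A q a < n"
  using dfa by (simp add: is_dfa_def)

lemma init_less [simp]: "init A < n"
  using dfa by (simp add: is_dfa_def)

lemma zero_in_value_set [simp]: "0 \<in> value_set b A q \<longleftrightarrow> q \<in> finals A"
  by (simp add: value_set_def digits.simps[of b 0])

lemma value_set_step: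
  assumes "q < n"
  shows "k \<in> value_set b A q \<longleftrightarrow> k div b \<in> value_set b A (delta A q (k mod b))"
proof (cases "k = 0")
  case True
  then show ?thesis using zero[OF assms] by simp
next
  case False
  then show ?thesis using base by (simp add: value_set_def digits.simps[of b k])
qed

lemma value_set_cons:
  assumes "q < n" "a < b"
  shows "a + b * k \<in> value_set b A q \<longleftrightarrow> k \<in> value_set b A (delta A q a)"
  using value_set_step[OF assms(1), of "a + b * k"] assms(2) by simp

text \<open>Reading a word is an affine change of the argument; this transports periods from the
  initial state to states reached later.\<close>

lemma value_set_foldl:
  assumes "q < n" "u \<in> lists {..<b}"
  shows "word_value b u + b ^ length u * k \<in> value_set b A q \<longleftrightarrow> k \<in> value_set b A (foldl (delta A) q u)"
  using assms
proof (induction u arbitrary: q)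
  case (Cons a u)
  have "word_value b (a # u) + b ^ length (a # u) * k = a + b * (word_value b u + b ^ length u * k)"
    by (simp add: algebra_simps)
  then show ?case using Cons value_set_cons[of q a] by (simp only:) simp
qed simp

lemma foldl_in_finals_iff:
  assumes "q < n" "u \<in> lists {..<b}"
  shows "foldl (delta A) q u \<in> finals A \<longleftrightarrow> word_value b u \<in> value_set b A q"
  using value_set_foldl[OF assms, of 0] by simp

lemma run_lang_eq: "q < n \<Longrightarrow> run_lang b A q = {u \<in> lists {..<b}. word_value b u \<in> value_set b A q}"
  using foldl_in_finals_iff by (auto simp: run_lang_def)

lemma accepts_set_iff: "accepts_set b A S \<longleftrightarrow> S = value_set b A (init A)"
proof -
  have "lang b A = {u \<in> lists {..<b}. word_value b u \<in> value_set b A (init A)}"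
    using run_lang_eq[OF init_less] by (simp add: lang_def run_lang_def)
  moreover have *: "S = T" if "{u \<in> lists {..<b}. word_value b u \<in> S} = {u \<in> lists {..<b}. word_value b u \<in> T}" for S T
  proof -
    have "k \<in> S \<longleftrightarrow> k \<in> T" for k
      using digits_in_lists[OF base, of k] word_value_digits[OF base, of k]
        eqset_imp_iff[OF that, of "digits b k"] by simp
    then show ?thesis by auto
  qed
  ultimately show ?thesis
    using *[of "value_set b A (init A)" S] unfolding accepts_set_def by auto
qed

text \<open>Right languages are determined by value sets, so injectivity carries over. This turns
  set identities into equations between transitions.\<close>

lemma value_set_inj:
  assumes "minimal_dfa b n A" "p < n" "q < n" "value_set b A p = value_set b A q"
  shows "p = q"
  using inj_onD[OF minimal_dfa_reachable_inj(2)[OF assms(1)], of p q] assms(2-4) by (simp add: run_lang_eq)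

end

text \<open>Appending \<open>0\<close> to a word keeps its value. By minimality every state is
  reachable, so this invariance spreads from the initial state to all states.\<close>

lemma value_dfa_if_accepts_set:
  assumes "b > 1" "minimal_dfa b n A" "accepts_set b A S"
  shows "value_dfa b n A"
proof
  show "is_dfa b n A" using assms(2) by (simp add: minimal_dfa_def)
  fix q assume "q < n"
  then obtain u where u: "u \<in> lists {..<b}" "q = foldl (delta A) (init A) u"
    using minimal_dfa_reachable_inj(1)[OF assms(2)] by blast
  have "word_value b (u @ [0]) = word_value b u" by (induction u) auto
  moreover have "u @ [0] \<in> lists {..<b}" using u(1) assms(1) by auto
  ultimately have "u \<in> lang b A \<longleftrightarrow> u @ [0] \<in> lang b A"
    using assms(3) u(1) by (simp add: accepts_set_def)
  then show "delta A q 0 \<in> finals A \<longleftrightarrow> q \<in> finals A"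
    using u \<open>u @ [0] \<in> lists {..<b}\<close> by (simp add: lang_def)
qed fact

section \<open>The core and the shift on it\<close>

text \<open>
  \<open>D\<close> abstracts the result of peeling off states of in-degree zero: \<open>pos\<close> numbers the
  removed states in the order of their removal.
\<close>

locale core = value_dfa +
  fixes D :: "nat set" and pos :: "nat \<Rightarrow> nat"
  assumes core_less: "\<And>q. q \<in> D \<Longrightarrow> q < n"
    and core_delta: "\<And>q a. q \<in> D \<Longrightarrow> a < b \<Longrightarrow> delta A q a \<in> D"
    and core_pred: "\<And>q. q \<in> D \<Longrightarrow> \<exists>p\<in>D. \<exists>a<b. delta A p a = q"
    and pos_delta: "\<And>q a. q < n \<Longrightarrow> q \<notin> D \<Longrightarrow> a < b \<Longrightarrow> delta A q a \<notin> D \<Longrightarrow> pos q < pos (delta A q a)"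
begin

lemma finite_core: "finite D"
  using core_less by (intro finite_subset[of D "{..<n}"]) auto

text \<open>Successors of a removed state lie in the core or were removed later, so the induction
  runs backwards through the removal order, with \<open>eventually_periodic_digits\<close> combining
  the successors.\<close>

lemma eventually_periodic_if_core:
  assumes "\<And>q. q \<in> D \<Longrightarrow> eventually_periodic (value_set b A q)" and "q < n"
  shows "eventually_periodic (value_set b A q)"
  using assms(2)
proof (induction "Max (pos ` {..<n}) - pos q" arbitrary: q rule: less_induct)
  case less
  show ?case
  proof (cases "q \<in> D")
    case False
    have "eventually_periodic (value_set b A (delta A q a))" if "a < b" for a
    proof (cases "delta A q a \<in> D")
      case notin: False
      have "pos (delta A q a) \<le> Max (pos ` {..<n})" using less.prems that by (intro Max_ge) auto
      moreover have "pos q < pos (delta A q a)" using pos_delta[OF less.prems False that notin] .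
      ultimately have "Max (pos ` {..<n}) - pos (delta A q a) < Max (pos ` {..<n}) - pos q" by linarith
      then show ?thesis using less.hyps less.prems that by simp
    qed (use assms(1) in auto)
    from eventually_periodic_digits[OF _ this value_set_step[OF less.prems]] base
    show ?thesis by simp
  qed (use assms(1) in auto)
qed

text \<open>
  These are the transitions that the residuals of \<open>{k. k + 1 \<in> S}\<close> must have: incrementing changes
  the first digit only, unless that digit is \<open>b - 1\<close> and a carry propagates.
\<close>

definition is_shift :: "(nat \<Rightarrow> nat) \<Rightarrow> bool" where
  "is_shift g \<longleftrightarrow> (\<forall>q\<in>D. g q \<in> D \<and>
     (\<forall>a<b. delta A (g q) a = (if Suc a < b then delta A q (Suc a) else g (delta A q 0))))"

text \<open>Strong induction on \<open>k\<close>: without a carry only the first digit changes, and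
  a carry leaves the same question for \<open>k div b\<close> at the \<open>0\<close>-successor of
  \<open>q\<close>.\<close>

lemma is_shift_value_set:
  assumes "is_shift g" "q \<in> D"
  shows "Suc k \<in> value_set b A q \<longleftrightarrow> k \<in> value_set b A (g q)"
  using assms(2)
proof (induction k arbitrary: q rule: less_induct)
  case (less k)
  have gq: "g q \<in> D" and dg: "\<And>a. a < b \<Longrightarrow> delta A (g q) a = (if Suc a < b then delta A q (Suc a) else g (delta A q 0))"
    using assms(1) less.prems by (auto simp: is_shift_def)
  have k: "k \<in> value_set b A (g q) \<longleftrightarrow> k div b \<in> value_set b A (delta A (g q) (k mod b))"
    using core_less[OF gq] by (rule value_set_step)
  have s: "Suc k \<in> value_set b A q \<longleftrightarrow> Suc k div b \<in> value_set b A (delta A q (Suc k mod b))"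
    using core_less[OF less.prems] by (rule value_set_step)
  show ?case
  proof (cases "Suc (k mod b) = b")
    case False
    then have "Suc k mod b = Suc (k mod b)" "Suc k div b = k div b" "Suc (k mod b) < b"
      using base by (auto simp: mod_Suc div_Suc intro: Suc_lessI)
    then show ?thesis using k s dg[of "k mod b"] by simp
  next
    case True
    then have m: "Suc k mod b = 0" "Suc k div b = Suc (k div b)" by (auto simp: mod_Suc div_Suc)
    \<comment> \<open>At \<open>k = 0\<close> no carry occurs because \<open>b > 1\<close>.\<close>
    have "k div b < k" using True base by (cases "k = 0") auto
    moreover have "delta A q 0 \<in> D" using core_delta less.prems base by simp
    ultimately show ?thesis using less.IH[of "k div b" "delta A q 0"] k s m dg[of "k mod b"] True base by simp
  qed
qed

text \<open>On the core, iterating the shift reduces membership of \<open>k\<close> to finality of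
  the \<open>k\<close>-th point of an orbit in a finite set.\<close>

lemma eventually_periodic_if_shift:
  assumes "is_shift g" "q < n"
  shows "eventually_periodic (value_set b A q)"
proof (rule eventually_periodic_if_core[OF _ assms(2)])
  fix q assume q: "q \<in> D"
  have "q \<in> D \<Longrightarrow> k \<in> value_set b A q \<longleftrightarrow> (g ^^ k) q \<in> finals A" for k q
  proof (induction k arbitrary: q)
    case (Suc k)
    have "g q \<in> D" using assms(1) Suc.prems by (simp add: is_shift_def)
    then show ?case using Suc is_shift_value_set[OF assms(1) Suc.prems] by (simp add: funpow_swap1)
  qed simp
  then have "value_set b A q = {k. (g ^^ k) q \<in> finals A}" using q by auto
  moreover have "eventually_periodic {k. (g ^^ k) q \<in> finals A}"
    using assms(1) by (intro eventually_periodic_orbit[OF finite_core q]) (simp add: is_shift_def)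
  ultimately show "eventually_periodic (value_set b A q)" by simp
qed

text \<open>Iterates \<open>core_pred\<close> backwards. The long words absorb both the threshold
  and the part of the period that shares factors with \<open>b\<close>.\<close>

lemma core_long_word:
  assumes "q \<in> D"
  shows "\<exists>p\<in>D. \<exists>u\<in>lists {..<b}. length u = m \<and> foldl (delta A) p u = q"
  using assms
proof (induction m arbitrary: q)
  case 0
  then show ?case by (intro bexI[of _ q] bexI[of _ "[]"]) auto
next
  case (Suc m)
  obtain p a where p: "p \<in> D" "a < b" "delta A p a = q" using core_pred[OF Suc.prems] by auto
  obtain p' u where "p' \<in> D" "u \<in> lists {..<b}" "length u = m" "foldl (delta A) p' u = p"
    using Suc.IH[OF p(1)] by auto
  then show ?case using p by (intro bexI[of _ p'] bexI[of _ "u @ [a]"]) auto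
qed

text \<open>A shift by \<open>r\<close> after reading \<open>w\<close> is a shift by
  \<open>b ^ length w * r\<close> at the initial state, a multiple of the original period once
  \<open>length w\<close> is at least \<open>m\<close>. As \<open>b ^ length w\<close> exceeds
  \<open>N\<close>, every \<open>k \<ge> 1\<close> lands beyond the threshold, while
  \<open>k = 0\<close> need not.\<close>

lemma core_period:
  assumes "minimal_dfa b n A" "eventually_periodic (value_set b A (init A))"
  shows "\<exists>r>0. coprime r b \<and> (\<forall>q\<in>D. \<forall>k\<ge>1. k + r \<in> value_set b A q \<longleftrightarrow> k \<in> value_set b A q)"
proof -
  obtain N p where p: "p > 0" "\<And>k. k \<ge> N \<Longrightarrow> k + p \<in> value_set b A (init A) \<longleftrightarrow> k \<in> value_set b A (init A)"
    using assms(2) by (auto simp: eventually_periodic_def)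
  obtain m r where r: "r > 0" "coprime r b" "p dvd b ^ m * r" using dvd_power_times_coprime[OF p(1)] by blast
  have "k + r \<in> value_set b A q \<longleftrightarrow> k \<in> value_set b A q" if q: "q \<in> D" and k: "k \<ge> 1" for q k
  proof -
    \<comment> \<open>The summand \<open>m\<close> serves divisibility by \<open>p\<close>, the
      summand \<open>N\<close> the threshold; the prefix \<open>v\<close> links the word to the
      initial state.\<close>
    obtain q' u where u: "q' \<in> D" "u \<in> lists {..<b}" "length u = m + N" "foldl (delta A) q' u = q"
      using core_long_word[OF q] by blast
    obtain v where v: "v \<in> lists {..<b}" "q' = foldl (delta A) (init A) v"
      using minimal_dfa_reachable_inj(1)[OF assms(1)] core_less[OF u(1)] by blast
    define w where "w = v @ u"
    have w: "w \<in> lists {..<b}" "foldl (delta A) (init A) w = q" "length w = m + N + length v"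
      using u v by (auto simp: w_def)
    have "b ^ length w * r = (b ^ N * b ^ length v) * (b ^ m * r)"
      by (simp add: w(3) power_add)
    then have "p dvd b ^ length w * r" using r(3) by (simp only: dvd_mult)
    then obtain j where j: "b ^ length w * r = j * p" by (metis dvd_def mult.commute)
    have "N < 2 ^ N" by (rule less_exp)
    also have "\<dots> \<le> b ^ N" using base by (intro power_mono) auto
    also have "\<dots> \<le> b ^ length w" using base w(3) by (intro power_increasing) auto
    also have "\<dots> \<le> b ^ length w * k" using k by simp
    finally have N: "N \<le> word_value b w + b ^ length w * k" by simp
    have "k + r \<in> value_set b A q \<longleftrightarrow> word_value b w + b ^ length w * (k + r) \<in> value_set b A (init A)"
      using value_set_foldl[OF init_less w(1)] w(2) by simp
    also have "word_value b w + b ^ length w * (k + r) = word_value b w + b ^ length w * k + j * p"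
      using j by (simp add: algebra_simps)
    also have "\<dots> \<in> value_set b A (init A) \<longleftrightarrow> word_value b w + b ^ length w * k \<in> value_set b A (init A)"
      using period_mult[OF p(2) N] .
    also have "\<dots> \<longleftrightarrow> k \<in> value_set b A q"
      using value_set_foldl[OF init_less w(1)] w(2) by simp
    finally show ?thesis .
  qed
  then show ?thesis using r by blast
qed

text \<open>A preimage under the digit \<open>0\<close> may a priori be missing, so \<open>g\<close>
  is constrained only where one exists. A period coprime to \<open>b\<close> makes this digit
  injective on the finite core, hence onto, and \<open>g\<close> is then constrained everywhere. The
  equations follow by comparing value sets.\<close>

lemma is_shift_if_eventually_periodic:
  assumes min: "minimal_dfa b n A" and per: "eventually_periodic (value_set b A (init A))"
    and g: "\<And>q. q \<in> D \<Longrightarrow> (\<exists>p\<in>D. delta A p 0 = delta A q 1) \<Longrightarrow> g q \<in> D \<and> delta A (g q) 0 = delta A q 1"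
  shows "is_shift g"
proof -
  obtain r where r: "r > 0" "coprime r b"
    and rq: "\<And>q k. q \<in> D \<Longrightarrow> k \<ge> 1 \<Longrightarrow> k + r \<in> value_set b A q \<longleftrightarrow> k \<in> value_set b A q"
    using core_period[OF min per] by blast
  have mult: "k + j * r \<in> value_set b A q \<longleftrightarrow> k \<in> value_set b A q" if "q \<in> D" "k \<ge> 1" for q k j
    using period_mult[of 1 r "value_set b A q" k j] rq that by blast
  \<comment> \<open>Since \<open>r\<close> is invertible modulo \<open>b\<close>, adding a multiple
    of it makes \<open>k\<close> divisible by \<open>b\<close>; \<open>y\<close> comes from
    Bezout.\<close>
  have div: "\<exists>i j. k + j * r = b * i" for k
  proof -
    obtain x y where "b * x = r * y + 1"
      using bezout_nat[of b r] r(2) base by (auto simp: coprime_iff_gcd_eq_1 gcd.commute)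
    then have "k * (b * x) = k * (r * y + 1)" by simp
    then have "k + (k * y) * r = b * (k * x)" by (simp add: algebra_simps)
    then show ?thesis by blast
  qed
  \<comment> \<open>One \<open>i\<close> serves all core states and both digits: membership of
    \<open>k\<close> depends only on the \<open>0\<close>-successor, and that of
    \<open>k + 1\<close> in the same way on the \<open>1\<close>-successor.\<close>
  have zero_div: "\<exists>i. \<forall>q\<in>D. \<forall>a<2. a + k \<in> value_set b A q \<longleftrightarrow> i \<in> value_set b A (delta A q a)" if k: "k \<ge> 1" for k
  proof -
    obtain i j where ij: "k + j * r = b * i" using div by blast
    have "a + k \<in> value_set b A q \<longleftrightarrow> i \<in> value_set b A (delta A q a)" if "q \<in> D" "a < 2" for q a
    proof -
      have "a + k \<in> value_set b A q \<longleftrightarrow> a + b * i \<in> value_set b A q"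
        using mult[OF that(1), of "a + k" j] k ij by (simp add: add.assoc)
      then show ?thesis using value_set_cons[of q a i] core_less[OF that(1)] that(2) base by simp
    qed
    then show ?thesis by blast
  qed
  \<comment> \<open>The number \<open>0\<close> is treated apart because the period holds only from
    \<open>1\<close> on; there \<open>0\<close> and \<open>1\<close> are read as single
    digits.\<close>
  have det: "value_set b A p = {k. Suc k \<in> value_set b A q}"
    if pq: "p \<in> D" "q \<in> D" "delta A p 0 = delta A q 1" for p q
  proof -
    have "k \<in> value_set b A p \<longleftrightarrow> Suc k \<in> value_set b A q" for k
    proof (cases "k = 0")
      case True
      then show ?thesis
        using value_set_cons[of p 0 0] value_set_cons[of q 1 0] pq core_less base by simp
    next
      case False
      then obtain i where "\<forall>q\<in>D. \<forall>a<2. a + k \<in> value_set b A q \<longleftrightarrow> i \<in> value_set b A (delta A q a)"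
        using zero_div[of k] by auto
      from this[rule_format, of p 0] this[rule_format, of q 1] show ?thesis using pq by simp
    qed
    then show ?thesis by auto
  qed
  have "inj_on (\<lambda>q. delta A q 0) D"
  proof (rule inj_onI)
    fix p q assume pq: "p \<in> D" "q \<in> D" "delta A p 0 = delta A q 0"
    have "k \<in> value_set b A p \<longleftrightarrow> k \<in> value_set b A q" for k
    proof (cases "k = 0")
      case True
      then show ?thesis
        using value_set_cons[of p 0 0] value_set_cons[of q 0 0] pq core_less base by simp
    next
      case False
      then obtain i where "\<forall>q\<in>D. \<forall>a<2. a + k \<in> value_set b A q \<longleftrightarrow> i \<in> value_set b A (delta A q a)"
        using zero_div[of k] by auto
      from this[rule_format, of p 0] this[rule_format, of q 0] show ?thesis using pq by simp
    qed
    then show "p = q"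
      by (intro value_set_inj[OF min] set_eqI) (use pq core_less in auto)
  qed
  \<comment> \<open>This supplies the preimages that the assumption on \<open>g\<close> asks
    for.\<close>
  then have surj: "(\<lambda>q. delta A q 0) ` D = D"
    using core_delta base by (intro endo_inj_surj finite_core) auto
  have gq: "g q \<in> D \<and> delta A (g q) 0 = delta A q 1" if q: "q \<in> D" for q
  proof -
    have "delta A q 1 \<in> (\<lambda>q. delta A q 0) ` D" using surj core_delta[OF q, of 1] base by simp
    then have "\<exists>p\<in>D. delta A p 0 = delta A q 1" by force
    then show ?thesis using g[OF q] by simp
  qed
  have sh: "k \<in> value_set b A (g q) \<longleftrightarrow> Suc k \<in> value_set b A q" if "q \<in> D" for q k
    using det gq that by auto
  show ?thesis unfolding is_shift_def
  proof (intro ballI conjI allI impI)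
    fix q assume "q \<in> D"
    then show "g q \<in> D" using gq by simp
  next
    fix q a assume q: "q \<in> D" and a: "a < b"
    have d0: "delta A q 0 \<in> D" using core_delta q base by simp
    have less: "delta A (g q) a < n" "delta A q 0 < n" "g (delta A q 0) < n" "q < n" "g q < n"
      using core_less core_delta gq q a d0 by auto
    show "delta A (g q) a = (if Suc a < b then delta A q (Suc a) else g (delta A q 0))"
    proof (cases "Suc a < b")
      case True
      have "k \<in> value_set b A (delta A (g q) a) \<longleftrightarrow> k \<in> value_set b A (delta A q (Suc a))" for k
        using value_set_cons[of "g q" a k] value_set_cons[of q "Suc a" k] sh[OF q] less a True by simp
      then have "delta A (g q) a = delta A q (Suc a)"
        by (intro value_set_inj[OF min] set_eqI) (use less True in auto)
      then show ?thesis using True by simp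
    next
      case False
      then have "a = b - 1" using a by simp
      have "k \<in> value_set b A (delta A (g q) a) \<longleftrightarrow> k \<in> value_set b A (g (delta A q 0))" for k
      proof -
        \<comment> \<open>With last digit \<open>b - 1\<close> the increment carries: the result is
          \<open>0 + b * Suc k\<close>, so the shift moves on to the
          \<open>0\<close>-successor.\<close>
        have "Suc (a + b * k) = b + b * k" using \<open>a = b - 1\<close> base by simp
        then have "Suc (a + b * k) \<in> value_set b A q \<longleftrightarrow> b + b * k \<in> value_set b A q"
          by (rule arg_cong)
        then show ?thesis
          using value_set_cons[of "g q" a k] value_set_cons[of q 0 "Suc k"] sh[OF q] sh[OF d0] less a base
          by simp
      qed
      then have "delta A (g q) a = g (delta A q 0)"
        by (intro value_set_inj[OF min] set_eqI) (use less in auto)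
      then show ?thesis using False by simp
    qed
  qed
qed

text \<open>The accepted set can only be the value set of the initial state, so the existential
  reduces to the periodicity of that set.\<close>

theorem periodic_iff_shift:
  assumes "minimal_dfa b n A"
    and "\<And>q. q \<in> D \<Longrightarrow> (\<exists>p\<in>D. delta A p 0 = delta A q 1) \<Longrightarrow> g q \<in> D \<and> delta A (g q) 0 = delta A q 1"
  shows "(\<exists>S. ultimately_periodic S \<and> accepts_set b A S) \<longleftrightarrow> is_shift g"
proof
  assume "\<exists>S. ultimately_periodic S \<and> accepts_set b A S"
  then have "eventually_periodic (value_set b A (init A))"
    by (auto simp: accepts_set_iff ultimately_periodic_iff)
  then show "is_shift g" using assms(2) by (rule is_shift_if_eventually_periodic[OF assms(1)])
next
  assume "is_shift g"
  then show "\<exists>S. ultimately_periodic S \<and> accepts_set b A S"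
    using eventually_periodic_if_shift[OF _ init_less] by (auto simp: accepts_set_iff ultimately_periodic_iff)
qed

end

section \<open>A structured language for the random access machine\<close>

text \<open>
  Loop bounds are restricted to the two inputs \<open>VB\<close> and \<open>VN\<close>, so that the running time of a
  program is a polynomial that can be read off its syntax.
\<close>

datatype var = VB | VN | VQ | VH | VA | VX | VY | VZ | VR | VS | VT | VG | VOne | VBad
datatype arr = Trans | Row | Final | Deg | Queue | Inv | Shift

record env =
  vars :: "var \<Rightarrow> nat"
  mem :: "arr \<Rightarrow> nat \<Rightarrow> nat"
  input :: "nat list"

datatype com =
    Skip
  | LetC var nat
  | AddC var var var
  | SubC var var var
  | Get var arr var
  | Put arr var var
  | ReadC var
  | Seq com com  (infixr \<open>;;\<close> 60)
  | Cond var com com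
  | For var var com

primrec sem :: "com \<Rightarrow> env \<Rightarrow> env" where
  "sem Skip s = s"
| "sem (LetC x c) s = s\<lparr>vars := (vars s)(x := c)\<rparr>"
| "sem (AddC x y z) s = s\<lparr>vars := (vars s)(x := vars s y + vars s z)\<rparr>"
| "sem (SubC x y z) s = s\<lparr>vars := (vars s)(x := vars s y - vars s z)\<rparr>"
| "sem (Get x a y) s = s\<lparr>vars := (vars s)(x := mem s a (vars s y))\<rparr>"
| "sem (Put a x y) s = s\<lparr>mem := (mem s)(a := (mem s a)(vars s x := vars s y))\<rparr>"
| "sem (ReadC x) s =
    s\<lparr>vars := (vars s)(x := (if input s = [] then 0 else hd (input s))), input := tl (input s)\<rparr>"
| "sem (c ;; d) s = sem d (sem c s)"
| "sem (Cond x c d) s = (if vars s x > 0 then sem c s else sem d s)"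
| "sem (For i m c) s =
    ((\<lambda>s. let s' = sem c s in s'\<lparr>vars := (vars s')(i := Suc (vars s' i))\<rparr>) ^^ vars s m)
      (s\<lparr>vars := (vars s)(i := 0)\<rparr>)"

primrec writes :: "com \<Rightarrow> var set" where
  "writes Skip = {}"
| "writes (LetC x c) = {x}"
| "writes (AddC x y z) = {x}"
| "writes (SubC x y z) = {x}"
| "writes (Get x a y) = {x}"
| "writes (Put a x y) = {}"
| "writes (ReadC x) = {x}"
| "writes (c ;; d) = writes c \<union> writes d"
| "writes (Cond x c d) = writes c \<union> writes d"
| "writes (For i m c) = insert i (writes c)"

text \<open>As the body changes neither counter nor bound, the fixed number of rounds in
  \<open>sem\<close> agrees with compiled code that tests the bound on each round.\<close>

primrec wf_com :: "com \<Rightarrow> bool" where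
  "wf_com Skip = True"
| "wf_com (LetC x c) = True"
| "wf_com (AddC x y z) = True"
| "wf_com (SubC x y z) = True"
| "wf_com (Get x a y) = True"
| "wf_com (Put a x y) = True"
| "wf_com (ReadC x) = True"
| "wf_com (c ;; d) = (wf_com c \<and> wf_com d)"
| "wf_com (Cond x c d) = (wf_com c \<and> wf_com d)"
| "wf_com (For i m c) = (wf_com c \<and> m \<in> {VB, VN} \<and> i \<noteq> m \<and> i \<notin> writes c \<and> m \<notin> writes c)"

lemma sem_notin_writes: "x \<notin> writes c \<Longrightarrow> vars (sem c s) x = vars s x"
proof (induction c arbitrary: s)
  case (For i m c)
  have "vars (((\<lambda>s. let s' = sem c s in s'\<lparr>vars := (vars s')(i := Suc (vars s' i))\<rparr>) ^^ k) s) x = vars s x" for k s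
    using For by (induction k) (auto simp: Let_def)
  then show ?case using For.prems by simp
qed auto

text \<open>Loop rule with the invariant indexed by the number of completed rounds; the increment of
  the counter is folded into the step.\<close>

lemma For_invariant:
  assumes wf: "wf_com (For i m c)" and "J 0 (s\<lparr>vars := (vars s)(i := 0)\<rparr>)"
    and step: "\<And>k s'. \<lbrakk>k < vars s m; J k s'; vars s' i = k; vars s' m = vars s m\<rbrakk>
      \<Longrightarrow> J (Suc k) ((sem c s')\<lparr>vars := (vars (sem c s'))(i := Suc k)\<rparr>)"
  shows "J (vars s m) (sem (For i m c) s)"
proof -
  define f where "f = (\<lambda>s. let s' = sem c s in s'\<lparr>vars := (vars s')(i := Suc (vars s' i))\<rparr>)"
  define s0 where "s0 = s\<lparr>vars := (vars s)(i := 0)\<rparr>"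
  have w: "i \<noteq> m" "i \<notin> writes c" "m \<notin> writes c" using wf by auto
  have f: "f s' = (sem c s')\<lparr>vars := (vars (sem c s'))(i := Suc (vars s' i))\<rparr>" for s'
    using w by (simp add: f_def Let_def sem_notin_writes)
  have "k \<le> vars s m \<Longrightarrow> J k ((f ^^ k) s0) \<and> vars ((f ^^ k) s0) i = k \<and> vars ((f ^^ k) s0) m = vars s m" for k
  proof (induction k)
    case 0
    show ?case unfolding funpow_0 using assms(2) w by (simp add: s0_def)
  next
    case (Suc k)
    then have *: "k < vars s m" "J k ((f ^^ k) s0)" "vars ((f ^^ k) s0) i = k" "vars ((f ^^ k) s0) m = vars s m"
      by auto
    have "J (Suc k) ((f ^^ Suc k) s0)" using step[OF *] f[of "(f ^^ k) s0"] *(3) by simp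
    then show ?case using * w f[of "(f ^^ k) s0"] by (simp add: sem_notin_writes)
  qed
  from this[OF order_refl] show ?thesis by (simp add: f_def s0_def)
qed

section \<open>Compilation to the random access machine\<close>

text \<open>
  Variables live at multiples of \<open>8\<close> and the interleaved arrays at the other residues modulo \<open>8\<close>,
  so that all arrays are unbounded and never overlap. Addresses \<open>0\<close> and \<open>8\<close> are scratch registers.
\<close>

primrec reg :: "var \<Rightarrow> nat" where
  "reg VB = 16" | "reg VN = 24" | "reg VQ = 32" | "reg VH = 40" | "reg VA = 48" | "reg VX = 56"
| "reg VY = 64" | "reg VZ = 72" | "reg VR = 80" | "reg VS = 88" | "reg VT = 96" | "reg VG = 104"
| "reg VOne = 112" | "reg VBad = 120"

primrec offset :: "arr \<Rightarrow> nat" where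
  "offset Trans = 1" | "offset Row = 2" | "offset Final = 3" | "offset Deg = 4"
| "offset Queue = 5" | "offset Inv = 6" | "offset Shift = 7"

lemma reg_inject [simp]: "reg x = reg y \<longleftrightarrow> x = y"
  by (cases x; cases y) simp_all

lemma offset_inject: "offset x = offset y \<Longrightarrow> x = y"
  by (cases x; cases y) simp_all

lemma reg_mod: "reg x mod 8 = 0" "reg x > 8"
  by (cases x; simp)+

declare reg.simps [simp del]

lemma offset_bounds: "offset a > 0" "offset a < 8"
  by (cases a; simp)+

lemma offset_nonzero [simp]: "offset a \<noteq> 0"
  using offset_bounds(1)[of a] by simp

abbreviation cell :: "arr \<Rightarrow> nat \<Rightarrow> nat" where
  "cell a i \<equiv> i * 8 + offset a"

lemma cell_inject [simp]: "cell a i = cell a' i' \<longleftrightarrow> a = a' \<and> i = i'"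
proof
  assume *: "cell a i = cell a' i'"
  have "offset a = cell a i mod 8" "offset a' = cell a' i' mod 8"
    using offset_bounds by simp_all
  then have "offset a = offset a'" using * by simp
  then show "a = a' \<and> i = i'" using * offset_inject by simp
qed simp

lemma cell_mod: "cell a i mod 8 \<noteq> 0"
  using offset_bounds[of a] by simp

lemma cell_neq [simp]: "cell a i \<noteq> reg x" "reg x \<noteq> cell a i" "cell a i \<noteq> 0" "cell a i \<noteq> 8"
  "0 \<noteq> cell a i" "8 \<noteq> cell a i"
  using cell_mod[of i a] reg_mod[of x] by (metis mod_0 mod_self)+

lemma reg_neq [simp]: "reg x \<noteq> 0" "reg x \<noteq> 8" "0 \<noteq> reg x" "8 \<noteq> reg x"
  using reg_mod[of x] by auto

text \<open>Registers outside the layout, in particular the scratch registers \<open>0\<close> and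
  \<open>8\<close>, stay unconstrained, so writing to them preserves \<open>rep\<close>.\<close>

definition rep :: "(nat \<Rightarrow> nat) \<Rightarrow> env \<Rightarrow> bool" where
  "rep X s \<longleftrightarrow> (\<forall>x. X (reg x) = vars s x) \<and> (\<forall>a i. X (cell a i) = mem s a i)"

primrec clen :: "com \<Rightarrow> nat" where
  "clen Skip = 0"
| "clen (LetC x c) = 1"
| "clen (AddC x y z) = 1"
| "clen (SubC x y z) = 1"
| "clen (Get x a y) = 6"
| "clen (Put a x y) = 6"
| "clen (ReadC x) = 1"
| "clen (c ;; d) = clen c + clen d"
| "clen (Cond x c d) = clen c + clen d + 3"
| "clen (For i m c) = clen c + 7"

text \<open>The factor \<open>8\<close> comes from three doublings; the cell address ends up in
  register \<open>0\<close>.\<close>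

definition addr :: "arr \<Rightarrow> var \<Rightarrow> instr list" where
  "addr a x = [Add 0 (reg x) (reg x), Add 0 0 0, Add 0 0 0, Const 8 (offset a), Add 0 0 8]"

text \<open>Jump targets are absolute, hence the argument \<open>pc\<close>. Setting register
  \<open>0\<close> to \<open>1\<close> makes the next jump unconditional. A loop is entered at its
  test, which stands behind the body.\<close>

primrec comp :: "nat \<Rightarrow> com \<Rightarrow> instr list" where
  "comp pc Skip = []"
| "comp pc (LetC x c) = [Const (reg x) c]"
| "comp pc (AddC x y z) = [Add (reg x) (reg y) (reg z)]"
| "comp pc (SubC x y z) = [Sub (reg x) (reg y) (reg z)]"
| "comp pc (Get x a y) = addr a y @ [Load (reg x) 0]"
| "comp pc (Put a x y) = addr a x @ [Store 0 (reg y)]"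
| "comp pc (ReadC x) = [Read (reg x)]"
| "comp pc (c ;; d) = comp pc c @ comp (pc + clen c) d"
| "comp pc (Cond x c d) =
    [Jump (reg x) (pc + clen d + 3)] @ comp (pc + 1) d
      @ [Const 0 1, Jump 0 (pc + clen d + 3 + clen c)] @ comp (pc + clen d + 3) c"
| "comp pc (For i m c) =
    [Const (reg i) 0, Const 0 1, Jump 0 (pc + 5 + clen c)] @ comp (pc + 3) c
      @ [Const 0 1, Add (reg i) (reg i) 0, Sub 0 (reg m) (reg i), Jump 0 (pc + 3)]"

lemma length_comp [simp]: "length (comp pc c) = clen c"
  by (induction c arbitrary: pc) (simp_all add: addr_def)

text \<open>A loop round adds two steps for the increment and two for the test; the \<open>5\<close>
  covers three entry steps and the final failing test. A conditional is charged for both branches,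
  so this is an upper bound.\<close>

primrec cost :: "nat \<Rightarrow> nat \<Rightarrow> com \<Rightarrow> nat" where
  "cost b n Skip = 0"
| "cost b n (LetC x c) = 1"
| "cost b n (AddC x y z) = 1"
| "cost b n (SubC x y z) = 1"
| "cost b n (Get x a y) = 6"
| "cost b n (Put a x y) = 6"
| "cost b n (ReadC x) = 1"
| "cost b n (c ;; d) = cost b n c + cost b n d"
| "cost b n (Cond x c d) = cost b n c + cost b n d + 3"
| "cost b n (For i m c) = (if m = VB then b else n) * (cost b n c + 4) + 5"

section \<open>Correctness and running time of compiled code\<close>

definition code_at :: "instr list \<Rightarrow> nat \<Rightarrow> instr list \<Rightarrow> bool" where
  "code_at P pc cs \<longleftrightarrow> (\<exists>ps qs. P = ps @ cs @ qs \<and> length ps = pc)"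

lemma code_at_append [simp]:
  "code_at P pc (cs @ ds) \<longleftrightarrow> code_at P pc cs \<and> code_at P (pc + length cs) ds"
proof
  assume "code_at P pc (cs @ ds)"
  then obtain ps qs where "P = ps @ (cs @ ds) @ qs" "length ps = pc"
    by (auto simp: code_at_def)
  then have "P = ps @ cs @ (ds @ qs)" "P = (ps @ cs) @ ds @ qs" "length ps = pc"
    "length (ps @ cs) = pc + length cs"
    by simp_all
  then show "code_at P pc cs \<and> code_at P (pc + length cs) ds"
    unfolding code_at_def by blast
next
  assume "code_at P pc cs \<and> code_at P (pc + length cs) ds"
  then obtain ps qs ps' qs' where *: "P = ps @ cs @ qs" "length ps = pc"
    "P = ps' @ ds @ qs'" "length ps' = pc + length cs"
    unfolding code_at_def by blast
  then have "(ps @ cs) @ qs = ps' @ (ds @ qs')" "length (ps @ cs) = length ps'" by simp_all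
  then have "ps' = ps @ cs" by (metis append_eq_append_conv)
  then show "code_at P pc (cs @ ds)" using * by (auto simp: code_at_def)
qed

lemma code_at_Cons:
  "code_at P pc (c # cs) \<longleftrightarrow> pc < length P \<and> P ! pc = c \<and> code_at P (Suc pc) cs"
proof -
  have "code_at P pc [c] \<longleftrightarrow> pc < length P \<and> P ! pc = c"
    by (auto simp: code_at_def nth_append intro: id_take_nth_drop)
      (metis append_Cons append_Nil id_take_nth_drop length_take less_imp_le min.absorb2)
  then show ?thesis using code_at_append[of P pc "[c]" cs] by simp
qed


definition runs :: "instr list \<Rightarrow> nat \<Rightarrow> config \<Rightarrow> config \<Rightarrow> bool" where
  "runs P t c c' \<longleftrightarrow> (\<exists>k\<le>t. (step P ^^ k) c = c')"

lemma runs_funpow: "(step P ^^ k) c = c' \<Longrightarrow> runs P k c c'"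
  by (auto simp: runs_def)

lemma runs_trans:
  assumes "runs P t c c'" "runs P t' c' c''"
  shows "runs P (t + t') c c''"
proof -
  obtain k k' where "k \<le> t" "(step P ^^ k) c = c'" "k' \<le> t'" "(step P ^^ k') c' = c''"
    using assms by (auto simp: runs_def)
  then show ?thesis
    unfolding runs_def by (intro exI[of _ "k' + k"]) (simp add: funpow_add)
qed

lemma runs_mono: "runs P t c c' \<Longrightarrow> t \<le> t' \<Longrightarrow> runs P t' c c'"
  unfolding runs_def using order_trans by blast

lemma runs_addr:
  assumes "code_at P pc (addr a x)" and "rep X s"
  shows "\<exists>X'. runs P 5 (pc, X, inp) (pc + 5, X', inp) \<and> rep X' s \<and> X' 0 = cell a (vars s x)"
proof (intro exI conjI)
  let ?X = "X(0 := cell a (vars s x), 8 := offset a)"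
  show "runs P 5 (pc, X, inp) (pc + 5, ?X, inp)"
    using assms unfolding addr_def
    by (intro runs_funpow) (auto simp: code_at_Cons rep_def step_def numeral_eq_Suc)
  show "rep ?X s" using assms(2) by (simp add: rep_def)
qed simp

text \<open>Quantifying over the surrounding program and the position makes the property
  compositional; fixing \<open>VB\<close> and \<open>VN\<close> ties the loop bounds to the
  arguments of \<open>cost\<close>.\<close>

definition implements :: "nat \<Rightarrow> nat \<Rightarrow> com \<Rightarrow> bool" where
  "implements b n c \<longleftrightarrow> (\<forall>P pc X s.
     code_at P pc (comp pc c) \<longrightarrow> rep X s \<longrightarrow> vars s VB = b \<longrightarrow> vars s VN = n \<longrightarrow>
     (\<exists>X'. runs P (cost b n c) (pc, X, input s) (pc + clen c, X', input (sem c s)) \<and> rep X' (sem c s)))"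

lemma implements_For:
  assumes c: "implements b n c" and wf: "wf_com (For i m c)" and out: "VB \<notin> writes (For i m c)" "VN \<notin> writes (For i m c)"
  shows "implements b n (For i m c)"
  unfolding implements_def
proof (intro allI impI)
  fix P pc X s
  assume code: "code_at P pc (comp pc (For i m c))" and rep: "rep X s"
    and b: "vars s VB = b" and n: "vars s VN = n"
  define N where "N = vars s m"
  have m: "vars s m = (if m = VB then b else n)" using wf b n by auto
  define f where "f = (\<lambda>s. let s' = sem c s in s'\<lparr>vars := (vars s')(i := Suc (vars s' i))\<rparr>)"
  define s0 where "s0 = s\<lparr>vars := (vars s)(i := 0)\<rparr>"
  let ?test = "pc + 5 + clen c"
  have cc: "code_at P (pc + 3) (comp (pc + 3) c)"
    using code by (auto simp: code_at_Cons numeral_eq_Suc)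
  have c0: "P ! pc = Const (reg i) 0" "P ! Suc pc = Const 0 1" "P ! Suc (Suc pc) = Jump 0 (pc + 5 + clen c)"
      "Suc (Suc pc) < length P"
    using code by (auto simp: code_at_Cons)
  have c1: "P ! (pc + 3 + clen c) = Const 0 1" "P ! (pc + 4 + clen c) = Add (reg i) (reg i) 0"
     "P ! (pc + 5 + clen c) = Sub 0 (reg m) (reg i)" "P ! (pc + 6 + clen c) = Jump 0 (pc + 3)" "pc + 6 + clen c < length P"
    using code by (auto simp: code_at_Cons numeral_eq_Suc)
  \<comment> \<open>The induction follows the moments when control is at the loop test, after
    \<open>k\<close> rounds; the \<open>3\<close> is the entry sequence.\<close>
  have loop: "k \<le> N \<Longrightarrow> \<exists>X'. runs P (k * (cost b n c + 4) + 3) (pc, X, input s) (?test, X', input ((f ^^ k) s0))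
     \<and> rep X' ((f ^^ k) s0) \<and> vars ((f ^^ k) s0) i = k \<and> vars ((f ^^ k) s0) VB = b \<and> vars ((f ^^ k) s0) VN = n" for k
  proof (induction k)
    case 0
    have "runs P 3 (pc, X, input s) (?test, X(reg i := 0, 0 := 1), input s)"
      using c0 by (intro runs_funpow) (simp add: step_def numeral_eq_Suc)
    moreover have "rep (X(reg i := 0, 0 := 1)) s0"
      using rep by (simp add: rep_def s0_def)
    ultimately show ?case using out b n by (auto simp: s0_def)
  next
    case (Suc k)
    let ?s = "(f ^^ k) s0"
    obtain X1 where X1: "runs P (k * (cost b n c + 4) + 3) (pc, X, input s) (?test, X1, input ?s)"
      "rep X1 ?s" "vars ?s i = k" "vars ?s VB = b" "vars ?s VN = n"
      using Suc by auto
    have m1: "vars ?s m = N" using X1(4,5) b n wf by (auto simp: N_def)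
    let ?X1 = "X1(0 := N - k)"
    have r1: "runs P 2 (?test, X1, input ?s) (pc + 3, ?X1, input ?s)"
      using c1 X1(2,3) m1 Suc.prems
      by (intro runs_funpow) (simp add: step_def rep_def numeral_eq_Suc)
    have "rep ?X1 ?s" using X1(2) by (simp add: rep_def)
    then obtain X2 where X2: "runs P (cost b n c) (pc + 3, ?X1, input ?s) (pc + 3 + clen c, X2, input (sem c ?s))"
      "rep X2 (sem c ?s)"
      using c cc X1(4,5) unfolding implements_def by blast
    define X3 where "X3 = X2(0 := 1, reg i := Suc (X2 (reg i)))"
    have r3: "runs P 2 (pc + 3 + clen c, X2, input (sem c ?s)) (?test, X3, input (sem c ?s))"
      using c1 by (intro runs_funpow) (simp add: X3_def step_def numeral_eq_Suc)
    have "rep X3 (f ?s)" using X2(2) by (simp add: X3_def rep_def f_def Let_def)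
    moreover have "runs P (Suc k * (cost b n c + 4) + 3) (pc, X, input s) (?test, X3, input (sem c ?s))"
      using runs_trans[OF runs_trans[OF X1(1) r1] runs_trans[OF X2(1) r3]] by (simp add: algebra_simps)
    moreover have "vars (f ?s) i = Suc k" "vars (f ?s) VB = b" "vars (f ?s) VN = n"
      "input (f ?s) = input (sem c ?s)"
      using X1(3-5) out wf by (auto simp: f_def Let_def sem_notin_writes)
    ultimately show ?case by (intro exI[of _ X3]) simp
  qed
  obtain X1 where X1: "runs P (N * (cost b n c + 4) + 3) (pc, X, input s) (?test, X1, input ((f ^^ N) s0))"
     "rep X1 ((f ^^ N) s0)" "vars ((f ^^ N) s0) i = N" "vars ((f ^^ N) s0) VB = b" "vars ((f ^^ N) s0) VN = n"
    using loop[of N] by auto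
  have m1: "vars ((f ^^ N) s0) m = N" using X1(4,5) b n wf by (auto simp: N_def)
  let ?X2 = "X1(0 := 0)"
  have "runs P 2 (?test, X1, input ((f ^^ N) s0)) (pc + 7 + clen c, ?X2, input ((f ^^ N) s0))"
    using c1 X1(2,3) m1
    by (intro runs_funpow) (simp add: step_def rep_def numeral_eq_Suc)
  from runs_trans[OF X1(1) this]
  have "runs P (cost b n (For i m c)) (pc, X, input s) (pc + clen (For i m c), ?X2, input ((f ^^ N) s0))"
    using m by (simp add: N_def algebra_simps)
  moreover have "rep ?X2 ((f ^^ N) s0)" using X1(2) by (simp add: rep_def)
  moreover have "(f ^^ N) s0 = sem (For i m c) s" by (simp add: f_def s0_def N_def)
  ultimately show "\<exists>X'. runs P (cost b n (For i m c)) (pc, X, input s)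
     (pc + clen (For i m c), X', input (sem (For i m c) s)) \<and> rep X' (sem (For i m c) s)"
    by auto
qed


lemma implements_com:
  assumes "wf_com c" "VB \<notin> writes c" "VN \<notin> writes c"
  shows "implements b n c"
  using assms
proof (induction c)
  case Skip
  show ?case unfolding implements_def by (auto simp: runs_def intro!: exI[of _ 0])
next
  case (LetC x k)
  show ?case unfolding implements_def
  proof (intro allI impI)
    fix P pc X s
    assume "code_at P pc (comp pc (LetC x k))" "rep X s"
    then show "\<exists>X'. runs P (cost b n (LetC x k)) (pc, X, input s) (pc + clen (LetC x k), X', input (sem (LetC x k) s))
        \<and> rep X' (sem (LetC x k) s)"
      by (intro exI[of _ "X(reg x := k)"] conjI runs_funpow)
        (auto simp: step_def code_at_Cons rep_def)
  qed
next
  case (AddC x y z)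
  show ?case unfolding implements_def
  proof (intro allI impI)
    fix P pc X s
    assume "code_at P pc (comp pc (AddC x y z))" "rep X s"
    then show "\<exists>X'. runs P (cost b n (AddC x y z)) (pc, X, input s) (pc + clen (AddC x y z), X', input (sem (AddC x y z) s))
        \<and> rep X' (sem (AddC x y z) s)"
      by (intro exI[of _ "X(reg x := X (reg y) + X (reg z))"] conjI runs_funpow)
        (auto simp: step_def code_at_Cons rep_def)
  qed
next
  case (SubC x y z)
  show ?case unfolding implements_def
  proof (intro allI impI)
    fix P pc X s
    assume "code_at P pc (comp pc (SubC x y z))" "rep X s"
    then show "\<exists>X'. runs P (cost b n (SubC x y z)) (pc, X, input s) (pc + clen (SubC x y z), X', input (sem (SubC x y z) s))
        \<and> rep X' (sem (SubC x y z) s)"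
      by (intro exI[of _ "X(reg x := X (reg y) - X (reg z))"] conjI runs_funpow)
        (auto simp: step_def code_at_Cons rep_def)
  qed
next
  case (ReadC x)
  show ?case unfolding implements_def
  proof (intro allI impI)
    fix P pc X s
    assume "code_at P pc (comp pc (ReadC x))" "rep X s"
    then show "\<exists>X'. runs P (cost b n (ReadC x)) (pc, X, input s) (pc + clen (ReadC x), X', input (sem (ReadC x) s))
        \<and> rep X' (sem (ReadC x) s)"
      by (intro exI[of _ "X(reg x := (if input s = [] then 0 else hd (input s)))"] conjI runs_funpow)
        (auto simp: step_def code_at_Cons rep_def)
  qed
next
  case (Get x a y)
  show ?case unfolding implements_def
  proof (intro allI impI)
    fix P pc X s
    assume code: "code_at P pc (comp pc (Get x a y))" and rep: "rep X s"
    obtain X1 where X1: "runs P 5 (pc, X, input s) (pc + 5, X1, input s)" "rep X1 s" "X1 0 = cell a (vars s y)"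
      using runs_addr[of P pc a y X s] code rep by auto
    have "runs P 1 (pc + 5, X1, input s) (pc + 6, X1(reg x := mem s a (vars s y)), input s)"
      using code X1(2,3) by (intro runs_funpow) (auto simp: step_def code_at_Cons rep_def addr_def numeral_eq_Suc)
    from runs_trans[OF X1(1) this]
    show "\<exists>X'. runs P (cost b n (Get x a y)) (pc, X, input s) (pc + clen (Get x a y), X', input (sem (Get x a y) s))
        \<and> rep X' (sem (Get x a y) s)"
      using X1(2) by (intro exI[of _ "X1(reg x := mem s a (vars s y))"]) (auto simp: rep_def)
  qed
next
  case (Put a x y)
  show ?case unfolding implements_def
  proof (intro allI impI)
    fix P pc X s
    assume code: "code_at P pc (comp pc (Put a x y))" and rep: "rep X s"
    obtain X1 where X1: "runs P 5 (pc, X, input s) (pc + 5, X1, input s)" "rep X1 s" "X1 0 = cell a (vars s x)"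
      using runs_addr[of P pc a x X s] code rep by auto
    have "runs P 1 (pc + 5, X1, input s) (pc + 6, X1(cell a (vars s x) := vars s y), input s)"
      using code X1(2,3) by (intro runs_funpow) (auto simp: step_def code_at_Cons rep_def addr_def numeral_eq_Suc)
    from runs_trans[OF X1(1) this]
    show "\<exists>X'. runs P (cost b n (Put a x y)) (pc, X, input s) (pc + clen (Put a x y), X', input (sem (Put a x y) s))
        \<and> rep X' (sem (Put a x y) s)"
      using X1(2) by (intro exI[of _ "X1(cell a (vars s x) := vars s y)"]) (auto simp: rep_def)
  qed
next
  case (Seq c d)
  show ?case unfolding implements_def
  proof (intro allI impI)
    fix P pc X s
    assume code: "code_at P pc (comp pc (c ;; d))" and rep: "rep X s"
      and b: "vars s VB = b" and n: "vars s VN = n"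
    have "implements b n c" "implements b n d" using Seq by auto
    note ** = this[unfolded implements_def, rule_format]
    obtain X1 where X1: "runs P (cost b n c) (pc, X, input s) (pc + clen c, X1, input (sem c s))" "rep X1 (sem c s)"
      using **(1) code rep b n by fastforce
    have "vars (sem c s) VB = b" "vars (sem c s) VN = n" using Seq.prems b n by (auto simp: sem_notin_writes)
    then obtain X2 where X2: "runs P (cost b n d) (pc + clen c, X1, input (sem c s)) (pc + clen c + clen d, X2, input (sem d (sem c s)))"
      "rep X2 (sem d (sem c s))"
      using **(2) code X1(2) by fastforce
    show "\<exists>X'. runs P (cost b n (c ;; d)) (pc, X, input s) (pc + clen (c ;; d), X', input (sem (c ;; d) s))
        \<and> rep X' (sem (c ;; d) s)"
      using runs_trans[OF X1(1) X2(1)] X2(2) by (auto simp: add.assoc)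
  qed
next
  case (Cond x c d)
  show ?case unfolding implements_def
  proof (intro allI impI)
    fix P pc X s
    assume code: "code_at P pc (comp pc (Cond x c d))" and rep: "rep X s"
      and b: "vars s VB = b" and n: "vars s VN = n"
    have "implements b n c" "implements b n d" using Cond by auto
    note ** = this[unfolded implements_def, rule_format]
    let ?pc = "pc + clen d + 3"
    have cd: "code_at P (pc + 1) (comp (pc + 1) d)" "code_at P ?pc (comp ?pc c)"
      using code by (auto simp: code_at_Cons numeral_eq_Suc)
    have J: "pc < length P" "P ! pc = Jump (reg x) ?pc"
       "pc + clen d + 2 < length P"
       "P ! (pc + clen d + 1) = Const 0 1" "P ! (pc + clen d + 2) = Jump 0 (?pc + clen c)"
      using code by (auto simp: code_at_Cons numeral_eq_Suc)
    show "\<exists>X'. runs P (cost b n (Cond x c d)) (pc, X, input s) (pc + clen (Cond x c d), X', input (sem (Cond x c d) s))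
        \<and> rep X' (sem (Cond x c d) s)"
    proof (cases "vars s x > 0")
      case True
      have j: "runs P 1 (pc, X, input s) (?pc, X, input s)"
        using J rep True by (intro runs_funpow) (simp add: step_def rep_def)
      obtain X1 where X1: "runs P (cost b n c) (?pc, X, input s) (?pc + clen c, X1, input (sem c s))" "rep X1 (sem c s)"
        using **(1)[OF cd(2) rep b n] by auto
      have "runs P (cost b n (Cond x c d)) (pc, X, input s) (?pc + clen c, X1, input (sem c s))"
        using runs_trans[OF j X1(1)] by (rule runs_mono) simp
      then show ?thesis using X1(2) True by (intro exI[of _ X1]) (simp add: algebra_simps)
    next
      case False
      have j: "runs P 1 (pc, X, input s) (pc + 1, X, input s)"
        using J rep False by (intro runs_funpow) (simp add: step_def rep_def)
      obtain X1 where X1: "runs P (cost b n d) (pc + 1, X, input s) (pc + 1 + clen d, X1, input (sem d s))" "rep X1 (sem d s)"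
        using **(2)[OF cd(1) rep b n] by auto
      have j': "runs P 2 (pc + 1 + clen d, X1, input (sem d s)) (?pc + clen c, X1(0 := 1), input (sem d s))"
        using J by (intro runs_funpow) (simp add: step_def numeral_eq_Suc)
      have "runs P (cost b n (Cond x c d)) (pc, X, input s) (?pc + clen c, X1(0 := 1), input (sem d s))"
        using runs_trans[OF runs_trans[OF j X1(1)] j'] by (rule runs_mono) simp
      moreover have "rep (X1(0 := 1)) (sem d s)" using X1(2) by (simp add: rep_def)
      ultimately show ?thesis using False by (intro exI[of _ "X1(0 := 1)"]) (simp add: algebra_simps)
    qed
  qed
next
  case (For i m c)
  then show ?case by (intro implements_For) auto
qed

section \<open>The decision procedure\<close>

definition load_row :: com where
  "load_row = For VA VB (ReadC VX ;; Put Trans VR VX ;; Get VY Deg VX ;; AddC VY VY VOne ;;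
     Put Deg VX VY ;; AddC VR VR VOne)"

text \<open>\<open>Row\<close> remembers the start \<open>q * b\<close> of each row, in place of a
  multiplication.\<close>

definition load_table :: com where
  "load_table = For VQ VN (Put Row VQ VR ;; load_row)"

definition load_finals :: com where
  "load_finals = For VQ VN (ReadC VX ;; Put Final VQ VX)"

text \<open>\<open>VT\<close> is the tail of the queue; its head is the loop counter
  \<open>VH\<close> of \<open>peel\<close>.\<close>

definition seed_queue :: com where
  "seed_queue = For VQ VN (Get VX Deg VQ ;; Cond VX Skip (Put Queue VT VQ ;; AddC VT VT VOne))"

text \<open>
  Once the degrees are final, \<open>Deg\<close> is positive exactly on the core. Each state enters \<open>Queue\<close> at
  most once, hence \<open>n\<close> iterations of the peeling loop suffice.
\<close>

definition remove_edge :: com where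
  "remove_edge = (AddC VX VR VA ;; Get VS Trans VX ;; Get VY Deg VS ;; SubC VY VY VOne ;;
     Put Deg VS VY ;; Cond VY Skip (Put Queue VT VS ;; AddC VT VT VOne))"

definition remove_edges :: com where
  "remove_edges = For VA VB remove_edge"

text \<open>Once the head has caught up with the tail, \<open>VT - VH\<close> is \<open>0\<close>
  and the remaining rounds idle.\<close>

definition peel :: com where
  "peel = For VH VN (SubC VX VT VH ;;
     Cond VX (Get VZ Queue VH ;; Get VR Row VZ ;; remove_edges) Skip)"

text \<open>Of several core states with the same \<open>0\<close>-successor the last one wins, which
  suffices for the assumption on \<open>g\<close> in \<open>periodic_iff_shift\<close>. Entries
  never written stay \<open>0\<close>; \<open>check_core\<close> tests whether the value found lies
  in the core.\<close>

definition invert_zero :: com where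
  "invert_zero = For VQ VN (Get VX Deg VQ ;;
     Cond VX (Get VR Row VQ ;; Get VY Trans VR ;; Put Inv VY VQ) Skip)"

definition compute_shift :: com where
  "compute_shift = For VQ VN (Get VR Row VQ ;; AddC VR VR VOne ;; Get VY Trans VR ;;
     Get VX Inv VY ;; Put Shift VQ VX)"

text \<open>
  With truncated subtraction \<open>(x - y) + (y - x)\<close> vanishes iff \<open>x = y\<close>; \<open>VBad\<close> accumulates these.
\<close>

definition compare :: com where
  "compare = (SubC VT VX VY ;; SubC VY VY VX ;; AddC VBad VBad VT ;; AddC VBad VBad VY)"

text \<open>On entry \<open>VR\<close> and \<open>VS\<close> hold the row starts of \<open>q\<close>
  and \<open>g q\<close>, and \<open>VZ\<close> the \<open>0\<close>-successor of \<open>q\<close>.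
  \<open>VT\<close> is positive exactly if \<open>Suc a < b\<close>.\<close>

definition check_row :: com where
  "check_row = For VA VB (AddC VX VS VA ;; Get VX Trans VX ;; AddC VH VA VOne ;; SubC VT VB VH ;;
     Cond VT (AddC VH VR VH ;; Get VY Trans VH) (Get VY Shift VZ) ;; compare)"

definition check_zero :: com where
  "check_zero = (Get VR Row VQ ;; Get VZ Trans VR ;; Get VX Final VQ ;; Get VY Final VZ ;; compare)"

definition check_core :: com where
  "check_core = (Get VG Shift VQ ;; Get VY Deg VG ;; Cond VY Skip (AddC VBad VBad VOne) ;; Get VS Row VG)"

definition check :: com where
  "check = For VQ VN (check_zero ;; Get VX Deg VQ ;; Cond VX (check_core ;; check_row) Skip)"

definition algorithm :: com where
  "algorithm = (ReadC VX ;; LetC VOne 1 ;; load_table ;; load_finals ;; seed_queue ;; peel ;;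
     invert_zero ;; compute_shift ;; check)"

lemmas program_defs = load_row_def load_table_def load_finals_def seed_queue_def remove_edge_def remove_edges_def
  peel_def invert_zero_def compute_shift_def compare_def check_row_def check_zero_def check_core_def check_def

text \<open>Parallel transitions count separately, matching the decrement performed for each
  letter.\<close>

definition indeg :: "nat \<Rightarrow> dfa \<Rightarrow> nat set \<Rightarrow> nat \<Rightarrow> nat" where
  "indeg b A U r = (\<Sum>q\<in>U. \<Sum>a<b. if delta A q a = r then 1 else 0)"

lemma indeg_pos_iff:
  assumes "finite U"
  shows "indeg b A U r > 0 \<longleftrightarrow> (\<exists>q\<in>U. \<exists>a<b. delta A q a = r)"
proof -
  have "indeg b A U r = 0 \<longleftrightarrow> (\<forall>q\<in>U. \<forall>a<b. delta A q a \<noteq> r)"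
    using assms by (auto simp: indeg_def)
  then show ?thesis by auto
qed

section \<open>Correctness of the phases\<close>

locale algorithm_run =
  fixes b n :: nat and A :: dfa
  assumes base: "b > 1" and dfa: "is_dfa b n A"
begin

lemma delta_less [simp]: "q < n \<Longrightarrow> a < b \<Longrightarrow> delta A q a < n"
  using dfa by (simp add: is_dfa_def)

lemma n_pos: "n > 0"
  using dfa by (auto simp: is_dfa_def)

lemma index_less: "q < m \<Longrightarrow> a < b \<Longrightarrow> q * b + a < m * b"
proof -
  assume "q < m" "a < b"
  then have "q * b + a < Suc q * b" "Suc q * b \<le> m * b" by (simp, intro mult_le_mono1) simp
  then show ?thesis by (rule less_le_trans)
qed

definition constants :: "env \<Rightarrow> bool" where
  "constants s \<longleftrightarrow> vars s VB = b \<and> vars s VN = n \<and> vars s VOne = 1 \<and> vars s VBad = 0"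

definition table :: "env \<Rightarrow> bool" where
  "table s \<longleftrightarrow> (\<forall>q<n. mem s Row q = q * b \<and> (\<forall>a<b. mem s Trans (q * b + a) = delta A q a))"

definition finals_bits :: "env \<Rightarrow> bool" where
  "finals_bits s \<longleftrightarrow> (\<forall>q<n. mem s Final q = (if q \<in> finals A then 1 else 0))"

lemma load_row:
  fixes s :: env
  assumes "constants s" "vars s VR = q * b" "input s = map (delta A q) [0..<b] @ inp"
  defines "s' \<equiv> sem load_row s"
  shows "constants s'" "vars s' VR = Suc q * b" "input s' = inp"
    and "\<And>x. x \<noteq> Trans \<Longrightarrow> x \<noteq> Deg \<Longrightarrow> mem s' x = mem s x"
    and "\<And>i. i < q * b \<Longrightarrow> mem s' Trans i = mem s Trans i"
    and "\<And>a. a < b \<Longrightarrow> mem s' Trans (q * b + a) = delta A q a"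
    and "\<And>r. mem s' Deg r = mem s Deg r + (\<Sum>a<b. if delta A q a = r then 1 else 0)"
    and "vars s' VT = vars s VT"
proof -
  let ?J = "\<lambda>k s'. constants s' \<and> vars s' VR = q * b + k \<and> input s' = map (delta A q) [k..<b] @ inp \<and>
    (\<forall>x. x \<noteq> Trans \<longrightarrow> x \<noteq> Deg \<longrightarrow> mem s' x = mem s x) \<and>
    (\<forall>i<q * b. mem s' Trans i = mem s Trans i) \<and>
    (\<forall>a<k. mem s' Trans (q * b + a) = delta A q a) \<and>
    (\<forall>r. mem s' Deg r = mem s Deg r + (\<Sum>a<k. if delta A q a = r then 1 else 0)) \<and>
    vars s' VT = vars s VT"
  have "?J (vars s VB) (sem load_row s)"
    unfolding load_row_def
  proof (rule For_invariant[where J = ?J], goal_cases)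
    case (3 k t)
    then have "k < b" using assms(1) by (simp add: constants_def)
    then have "[k..<b] = k # [Suc k..<b]" by (rule upt_conv_Cons)
    then have i: "input t = delta A q k # map (delta A q) [Suc k..<b] @ inp" using 3(2) by simp
    show ?case using 3(2) i by (simp add: constants_def less_Suc_eq fun_eq_iff)
  qed (use assms in \<open>simp_all add: constants_def\<close>)
  then show "constants s'" "vars s' VR = Suc q * b" "input s' = inp"
    and "\<And>x. x \<noteq> Trans \<Longrightarrow> x \<noteq> Deg \<Longrightarrow> mem s' x = mem s x"
    and "\<And>i. i < q * b \<Longrightarrow> mem s' Trans i = mem s Trans i"
    and "\<And>a. a < b \<Longrightarrow> mem s' Trans (q * b + a) = delta A q a"
    and "\<And>r. mem s' Deg r = mem s Deg r + (\<Sum>a<b. if delta A q a = r then 1 else 0)"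
    and "vars s' VT = vars s VT"
    using assms(1) unfolding s'_def constants_def by (simp_all add: add.commute)
qed


lemma load_table:
  assumes "constants s" "vars s VR = 0" "input s = concat (map (\<lambda>q. map (delta A q) [0..<b]) [0..<n]) @ inp"
    and "\<And>r. mem s Deg r = 0"
  defines "s' \<equiv> sem load_table s"
  shows "constants s'" "table s'" "input s' = inp" "vars s' VT = vars s VT"
    and "\<And>r. mem s' Deg r = indeg b A {..<n} r" and "mem s' Inv = mem s Inv"
proof -
  let ?J = "\<lambda>k s'. constants s' \<and> vars s' VR = k * b \<and> vars s' VT = vars s VT \<and>
    input s' = concat (map (\<lambda>q. map (delta A q) [0..<b]) [k..<n]) @ inp \<and> mem s' Inv = mem s Inv \<and>
    (\<forall>q<k. mem s' Row q = q * b \<and> (\<forall>a<b. mem s' Trans (q * b + a) = delta A q a)) \<and>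
    (\<forall>r. mem s' Deg r = indeg b A {..<k} r)"
  have "?J (vars s VN) (sem load_table s)"
    unfolding load_table_def
  proof (rule For_invariant[where J = ?J], goal_cases)
    case 1
    show ?case by (simp add: load_row_def)
  next
    case 2
    show ?case using assms by (simp add: constants_def indeg_def)
  next
    case (3 k t)
    then have "k < n" using assms(1) by (simp add: constants_def)
    then have upt: "[k..<n] = k # [Suc k..<n]" by (rule upt_conv_Cons)
    let ?t = "sem (Put Row VQ VR) t"
    have "constants ?t" "vars ?t VR = k * b"
      "input ?t = map (delta A k) [0..<b] @ concat (map (\<lambda>q. map (delta A q) [0..<b]) [Suc k..<n]) @ inp"
      using 3 upt by (simp_all add: constants_def)
    note r = load_row[OF this]
    have m: "mem (sem load_row ?t) Row = (mem t Row)(k := k * b)" "mem (sem load_row ?t) Inv = mem t Inv"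
      using 3 r(4)[of Row] r(4)[of Inv] by simp_all
    have tr: "mem (sem load_row ?t) Trans (q * b + a) = delta A q a" if "q < Suc k" "a < b" for q a
      using r(5)[OF index_less[of q k a]] r(6)[of a] that 3(2) by (cases "q = k") auto
    have "mem (sem load_row ?t) Deg r = indeg b A {..<Suc k} r" for r
      using r(7)[of r] 3(2) by (simp add: indeg_def lessThan_Suc add.commute)
    then show ?case
      using r(1-3,8) m tr 3(2) by (auto simp: constants_def less_Suc_eq)
  qed
  then show "constants s'" "table s'" "input s' = inp" "vars s' VT = vars s VT"
    "\<And>r. mem s' Deg r = indeg b A {..<n} r" "mem s' Inv = mem s Inv"
    using assms(1) unfolding s'_def table_def by (simp_all add: constants_def)
qed

lemma load_finals:
  assumes "constants s" "table s" "input s = map (\<lambda>q. if q \<in> finals A then 1 else 0) [0..<n]"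
  defines "s' \<equiv> sem load_finals s"
  shows "constants s'" "table s'" "finals_bits s'"
    and "vars s' VT = vars s VT" "\<And>x. x \<noteq> Final \<Longrightarrow> mem s' x = mem s x"
proof -
  let ?J = "\<lambda>k s'. constants s' \<and> vars s' VT = vars s VT \<and> (\<forall>x. x \<noteq> Final \<longrightarrow> mem s' x = mem s x) \<and>
    input s' = map (\<lambda>q. if q \<in> finals A then 1 else 0) [k..<n] \<and>
    (\<forall>q<k. mem s' Final q = (if q \<in> finals A then 1 else 0))"
  have J: "?J (vars s VN) (sem load_finals s)"
    unfolding load_finals_def
  proof (rule For_invariant[where J = ?J], goal_cases)
    case (3 k t)
    then have "k < n" using assms(1) by (simp add: constants_def)
    then have upt: "[k..<n] = k # [Suc k..<n]" by (rule upt_conv_Cons)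
    then show ?case using 3 by (simp add: constants_def less_Suc_eq fun_eq_iff)
  qed (use assms in \<open>simp_all add: constants_def\<close>)
  show "constants s'" "table s'" "finals_bits s'"
    "vars s' VT = vars s VT" "\<And>x. x \<noteq> Final \<Longrightarrow> mem s' x = mem s x"
    using assms(1,2) J unfolding s'_def table_def finals_bits_def by (simp_all add: constants_def)
qed


text \<open>The queue keeps processed states as well; its injectivity will bound its length by
  \<open>n\<close>.\<close>

definition queued :: "env \<Rightarrow> bool" where
  "queued s \<longleftrightarrow> inj_on (mem s Queue) {..<vars s VT} \<and>
    mem s Queue ` {..<vars s VT} = {r. r < n \<and> mem s Deg r = 0}"

lemma enqueue:
  assumes "inj_on L {..<t}" "L ` {..<t} = Z" "r \<notin> Z"
  shows "inj_on (L(t := r)) {..<Suc t}" "L(t := r) ` {..<Suc t} = insert r Z"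
proof -
  have "inj_on (L(t := r)) {..<t}" using assms(1) by (simp add: inj_on_def)
  moreover have im: "L(t := r) ` {..<t} = Z" using assms(2) by auto
  ultimately show "inj_on (L(t := r)) {..<Suc t}" using assms(3) unfolding lessThan_Suc
    by (subst inj_on_insert) (simp add: im del: fun_upd_apply, auto)
  show "L(t := r) ` {..<Suc t} = insert r Z"
    unfolding lessThan_Suc image_insert im by simp
qed

lemma seed_queue:
  assumes "constants s" "table s" "vars s VT = 0"
  defines "s' \<equiv> sem seed_queue s"
  shows "constants s'" "table s'" "queued s'" "\<And>x. x \<noteq> Queue \<Longrightarrow> mem s' x = mem s x"
proof -
  let ?J = "\<lambda>k s'. constants s' \<and> (\<forall>x. x \<noteq> Queue \<longrightarrow> mem s' x = mem s x) \<and>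
    inj_on (mem s' Queue) {..<vars s' VT} \<and> mem s' Queue ` {..<vars s' VT} = {r. r < k \<and> mem s Deg r = 0}"
  have J: "?J (vars s VN) (sem seed_queue s)"
    unfolding seed_queue_def
  proof (rule For_invariant[where J = ?J], goal_cases)
    case (3 k t)
    show ?case
    proof (cases "mem s Deg k = 0")
      case True
      have "{r. r < Suc k \<and> mem s Deg r = 0} = insert k {r. r < k \<and> mem s Deg r = 0}"
        using True by (auto simp: less_Suc_eq)
      then show ?thesis
        using 3 True enqueue[of "mem t Queue" "vars t VT" "{r. r < k \<and> mem s Deg r = 0}" k]
        by (simp add: constants_def)
    next
      case False
      then have "{r. r < Suc k \<and> mem s Deg r = 0} = {r. r < k \<and> mem s Deg r = 0}"
        by (auto simp: less_Suc_eq)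
      then show ?thesis using 3 False by (simp add: constants_def)
    qed
  qed (use assms in \<open>simp_all add: constants_def\<close>)
  then show "constants s'" "table s'" "queued s'" "\<And>x. x \<noteq> Queue \<Longrightarrow> mem s' x = mem s x"
    using assms(1,2) unfolding s'_def table_def queued_def by (simp_all add: constants_def)
qed

lemma queued_vars [simp]: "v VT = vars s VT \<Longrightarrow> queued (s\<lparr>vars := v\<rparr>) = queued s"
  by (simp add: queued_def)

lemma table_vars [simp]: "table (s\<lparr>vars := v\<rparr>) = table s"
  by (simp add: table_def)

lemma remove_edge:
  assumes "constants s" "vars s VR + vars s VA = i" "mem s Trans i = r"
  defines "s' \<equiv> sem remove_edge s"
  shows "constants s'" "vars s' VR = vars s VR"
    and "\<And>x. x \<noteq> Deg \<Longrightarrow> x \<noteq> Queue \<Longrightarrow> mem s' x = mem s x"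
    and "mem s' Deg = (mem s Deg)(r := mem s Deg r - 1)"
    and "mem s' Queue = (if mem s Deg r - 1 = 0 then (mem s Queue)(vars s VT := r) else mem s Queue)"
    and "vars s' VT = (if mem s Deg r - 1 = 0 then Suc (vars s VT) else vars s VT)"
  using assms by (simp_all add: remove_edge_def constants_def)

text \<open>\<open>U\<close> stands for the remaining states without \<open>q\<close>. Whenever an
  edge of \<open>q\<close> is deleted, its target still has positive degree and so is not yet
  queued; this yields the last conclusion, which fixes the order of removal.\<close>

lemma remove_edges:
  assumes "constants s" "table s" "queued s" "h < vars s VT" "mem s Queue h = q" "vars s VR = q * b"
    and "\<And>r. mem s Deg r = indeg b A U r + (\<Sum>a<b. if delta A q a = r then 1 else 0)"
  defines "s' \<equiv> sem remove_edges s"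
  shows "constants s'" "table s'" "queued s'" "vars s VT \<le> vars s' VT"
    and "\<And>x. x \<noteq> Deg \<Longrightarrow> x \<noteq> Queue \<Longrightarrow> mem s' x = mem s x"
    and "\<And>l. l < vars s VT \<Longrightarrow> mem s' Queue l = mem s Queue l"
    and "\<And>r. mem s' Deg r = indeg b A U r"
    and "\<And>a l. a < b \<Longrightarrow> l \<le> h \<Longrightarrow> mem s Queue l \<noteq> delta A q a"
proof -
  let ?J = "\<lambda>k s'. constants s' \<and> queued s' \<and> vars s VT \<le> vars s' VT \<and> vars s' VR = q * b \<and>
    (\<forall>x. x \<noteq> Deg \<longrightarrow> x \<noteq> Queue \<longrightarrow> mem s' x = mem s x) \<and>
    (\<forall>l<vars s VT. mem s' Queue l = mem s Queue l) \<and>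
    (\<forall>r. mem s' Deg r = indeg b A U r + (\<Sum>a\<in>{k..<b}. if delta A q a = r then 1 else 0)) \<and>
    (\<forall>a<k. \<forall>l\<le>h. mem s Queue l \<noteq> delta A q a)"
  have "q \<in> mem s Queue ` {..<vars s VT}" using assms(4,5) by auto
  then have q: "q < n" using assms(3) by (simp add: queued_def)
  have J: "?J (vars s VB) (sem remove_edges s)"
    unfolding remove_edges_def
  proof (rule For_invariant[where J = ?J], goal_cases)
    case 2
    then show ?case using assms by (simp add: constants_def queued_def lessThan_atLeast0)
  next
    case (3 k t)
    then have k: "k < b" using assms(1) by (simp add: constants_def)
    let ?r = "delta A q k"
    have "{k..<b} = insert k {Suc k..<b}" using k by auto
    then have deg: "mem t Deg r = indeg b A U r + (\<Sum>a\<in>{Suc k..<b}. if delta A q a = r then 1 else 0)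
        + (if ?r = r then 1 else 0)" for r
      using 3(2) by simp
    have q': "mem t Queue ` {..<vars t VT} = {r. r < n \<and> mem t Deg r = 0}"
      "inj_on (mem t Queue) {..<vars t VT}" using 3(2) by (simp_all add: queued_def)
    have r: "?r < n" "?r \<notin> {r. r < n \<and> mem t Deg r = 0}" using q k deg by auto
    have neq: "mem s Queue l \<noteq> ?r" if "l \<le> h" for l
    proof -
      have "l < vars s VT" using that assms(4) by simp
      then have "mem s Queue l = mem t Queue l" "l < vars t VT" using 3(2) by auto
      then have "mem s Queue l \<in> {r. r < n \<and> mem t Deg r = 0}" using q'(1) by (metis imageI lessThan_iff)
      then show ?thesis using r(2) by metis
    qed
    have tr: "mem t Trans (q * b + k) = ?r" using 3(2) assms(2) q k by (simp add: table_def)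
    \<comment> \<open>The edge being deleted is still counted, so the truncated subtraction is
      exact.\<close>
    have deg': "(mem t Deg)(?r := mem t Deg ?r - 1) = (\<lambda>r. indeg b A U r + (\<Sum>a\<in>{Suc k..<b}. if delta A q a = r then 1 else 0))"
      using deg by (auto simp: fun_eq_iff)
    let ?t = "sem remove_edge t"
    have "constants t" "vars t VR + vars t VA = q * b + k" using 3 by simp_all
    note t = remove_edge[OF this tr]
    have "queued ?t"
    proof (cases "mem t Deg ?r - 1 = 0")
      case True
      have "{r. r < n \<and> ((mem t Deg)(?r := mem t Deg ?r - 1)) r = 0} = insert ?r {r. r < n \<and> mem t Deg r = 0}"
        using True r(1) by auto
      with enqueue[OF q'(2,1) r(2)] True show ?thesis unfolding queued_def t(4-6) by simp
    next
      case False
      have "{r. r < n \<and> ((mem t Deg)(?r := mem t Deg ?r - 1)) r = 0} = {r. r < n \<and> mem t Deg r = 0}"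
        using False by auto
      with q' False show ?thesis unfolding queued_def t(4-6) by simp
    qed
    moreover have "\<forall>r. mem ?t Deg r = indeg b A U r + (\<Sum>a\<in>{Suc k..<b}. if delta A q a = r then 1 else 0)"
      unfolding t(4) deg' by simp
    moreover have "\<forall>l<vars s VT. mem ?t Queue l = mem s Queue l" "vars s VT \<le> vars ?t VT"
      using 3(2) by (auto simp: t(5,6))
    moreover have "\<forall>a<Suc k. \<forall>l\<le>h. mem s Queue l \<noteq> delta A q a"
      using neq 3(2) by (simp add: less_Suc_eq)
    ultimately show ?case
      using t(1-3) 3(2) by (simp add: constants_def queued_def)
  qed (simp add: remove_edge_def)
  then show "constants s'" "table s'" "queued s'" "vars s VT \<le> vars s' VT"
    "\<And>x. x \<noteq> Deg \<Longrightarrow> x \<noteq> Queue \<Longrightarrow> mem s' x = mem s x"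
    "\<And>l. l < vars s VT \<Longrightarrow> mem s' Queue l = mem s Queue l"
    "\<And>r. mem s' Deg r = indeg b A U r"
    "\<And>a l. a < b \<Longrightarrow> l \<le> h \<Longrightarrow> mem s Queue l \<noteq> delta A q a"
    using assms(1,2) unfolding s'_def table_def by (simp_all add: constants_def)
qed

text \<open>After \<open>h\<close> rounds the first \<open>min h VT\<close> queue entries are
  processed, and \<open>Deg\<close> counts the edges from all other states. The queue has at most
  \<open>n\<close> entries, so in the end all are processed. Then \<open>D\<close> consists of the
  states with a predecessor in \<open>D\<close>, which gives both closure and predecessors.\<close>

lemma peel:
  assumes "constants s" "table s" "queued s" "\<And>r. mem s Deg r = indeg b A {..<n} r"
  defines "s' \<equiv> sem peel s"
  defines "D \<equiv> {q. q < n \<and> mem s' Deg q > 0}"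
  shows "constants s'" "table s'" "\<And>x. x \<noteq> Deg \<Longrightarrow> x \<noteq> Queue \<Longrightarrow> mem s' x = mem s x"
    and "\<And>q a. q \<in> D \<Longrightarrow> a < b \<Longrightarrow> delta A q a \<in> D"
    and "\<And>q. q \<in> D \<Longrightarrow> \<exists>p\<in>D. \<exists>a<b. delta A p a = q"
    and "\<exists>pos :: nat \<Rightarrow> nat. \<forall>q a. q < n \<longrightarrow> q \<notin> D \<longrightarrow> a < b \<longrightarrow> delta A q a \<notin> D \<longrightarrow> pos q < pos (delta A q a)"
proof -
  let ?J = "\<lambda>h s'. constants s' \<and> table s' \<and> queued s' \<and>
    (\<forall>x. x \<noteq> Deg \<longrightarrow> x \<noteq> Queue \<longrightarrow> mem s' x = mem s x) \<and>
    (\<forall>r. mem s' Deg r = indeg b A ({..<n} - mem s' Queue ` {..<min h (vars s' VT)}) r) \<and>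
    (\<forall>i<min h (vars s' VT). \<forall>a<b. \<forall>l\<le>i. mem s' Queue l \<noteq> delta A (mem s' Queue i) a)"
  have "?J (vars s VN) (sem peel s)"
    unfolding peel_def
  proof (rule For_invariant[where J = ?J], goal_cases)
    case 1
    show ?case by (simp add: remove_edges_def remove_edge_def)
  next
    case 2
    then show ?case using assms by (simp add: constants_def queued_def table_def)
  next
    case (3 h t)
    show ?case
    proof (cases "h < vars t VT")
      case False
      then have "min (Suc h) (vars t VT) = vars t VT" "min h (vars t VT) = vars t VT" by simp_all
      then show ?thesis using 3(2-4) False by (simp add: constants_def)
    next
      case True
      let ?L = "mem t Queue"
      define q where "q = ?L h"
      let ?u = "sem (SubC VX VT VH ;; Get VZ Queue VH ;; Get VR Row VZ) t"
      let ?U = "{..<n} - ?L ` {..<Suc h}"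
      have t: "constants t" "table t" "queued t" using 3(2) by simp_all
      have inj: "inj_on ?L {..<vars t VT}" using 3(2) by (simp add: queued_def)
      have "q \<in> ?L ` {..<vars t VT}" using True by (simp add: q_def)
      then have q: "q < n" using 3(2) by (simp add: queued_def)
      have row: "mem t Row q = q * b" using t(2) q by (simp add: table_def)
      have "q \<notin> ?L ` {..<h}"
      proof
        assume "q \<in> ?L ` {..<h}"
        then obtain i where "i < h" "?L i = ?L h" by (auto simp: q_def)
        then show False using inj_onD[OF inj, of i h] True by simp
      qed
      then have ins: "{..<n} - ?L ` {..<h} = insert q ?U" "q \<notin> ?U"
        using q by (auto simp: q_def less_Suc_eq)
      have "indeg b A ({..<n} - ?L ` {..<h}) r = indeg b A ?U r + (\<Sum>a<b. if delta A q a = r then 1 else 0)" for r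
        using ins by (simp add: indeg_def)
      then have deg: "mem t Deg r = indeg b A ?U r + (\<Sum>a<b. if delta A q a = r then 1 else 0)" for r
        using 3(2) True by simp
      have u: "constants ?u" "table ?u" "queued ?u" "h < vars ?u VT" "mem ?u Queue h = q" "vars ?u VR = q * b"
        "mem ?u = mem t" "vars ?u VT = vars t VT"
        using t row 3(3) True by (simp_all add: constants_def q_def)
      have "\<And>r. mem ?u Deg r = indeg b A ?U r + (\<Sum>a<b. if delta A q a = r then 1 else 0)"
        using deg u(7) by simp
      note r = remove_edges[OF u(1-6) this, unfolded u(7,8)]
      let ?v = "sem remove_edges ?u"
      have min: "min (Suc h) (vars ?v VT) = Suc h" using r(4) True by simp
      have L: "mem ?v Queue i = ?L i" if "i \<le> h" for i using r(6)[of i] that True by simp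
      have "mem ?v Queue ` {..<Suc h} = ?L ` {..<Suc h}" using L by (intro image_cong) auto
      moreover have "mem ?v Queue l \<noteq> delta A (mem ?v Queue i) a" if "i < Suc h" "a < b" "l \<le> i" for i a l
      proof (cases "i = h")
        case True
        then show ?thesis using r(8)[of a l] L that by (simp add: q_def)
      next
        case False
        then show ?thesis using 3(2) L that True by simp
      qed
      ultimately show ?thesis
        using r(1-5,7) min 3(2,3) True by (simp add: constants_def)
    qed
  qed
  then have J: "?J n s'" using assms(1) by (simp add: constants_def s'_def)
  let ?t = "vars s' VT" let ?L = "mem s' Queue"
  have deg: "mem s' Deg r = indeg b A ({..<n} - ?L ` {..<min n ?t}) r" for r using J by simp
  have ord: "?L l \<noteq> delta A (?L i) a" if "i < min n ?t" "a < b" "l \<le> i" for i a l using J that by blast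
  have "queued s'" using J by simp
  then have inj: "inj_on ?L {..<?t}" and im: "?L ` {..<?t} = {r. r < n \<and> mem s' Deg r = 0}"
    by (simp_all add: queued_def)
  have "card (?L ` {..<?t}) \<le> card {..<n}" unfolding im by (intro card_mono) auto
  then have t: "?t \<le> n" using inj by (simp add: card_image)
  have "{..<n} - ?L ` {..<?t} = D" unfolding im D_def by auto
  then have deg: "mem s' Deg r = indeg b A D r" for r using deg[of r] t by (simp add: min_absorb2)
  have fin: "finite D" by (simp add: D_def)
  show "constants s'" "table s'" "\<And>x. x \<noteq> Deg \<Longrightarrow> x \<noteq> Queue \<Longrightarrow> mem s' x = mem s x"
    using J by simp_all
  have "r \<in> D \<longleftrightarrow> r < n \<and> mem s' Deg r > 0" for r by (simp add: D_def)
  then have D_iff: "r \<in> D \<longleftrightarrow> r < n \<and> (\<exists>q\<in>D. \<exists>a<b. delta A q a = r)" for r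
    unfolding deg indeg_pos_iff[OF fin] .
  show "delta A q a \<in> D" if "q \<in> D" "a < b" for q a
  proof -
    have "q < n" using that(1) D_iff by blast
    then show ?thesis using D_iff[of "delta A q a"] that by auto
  qed
  show "\<exists>p\<in>D. \<exists>a<b. delta A p a = q" if "q \<in> D" for q
    using that D_iff by blast
  have D: "r \<in> ?L ` {..<?t}" if "r < n" "r \<notin> D" for r
    using that im by (simp add: D_def)
  \<comment> \<open>States are numbered by queue position; \<open>ord\<close> excludes successors at
    the same or an earlier position.\<close>
  let ?pos = "inv_into {..<?t} ?L"
  have "?pos q < ?pos (delta A q a)" if qa: "q < n" "q \<notin> D" "a < b" "delta A q a \<notin> D" for q a
  proof -
    obtain i where i: "i < ?t" "q = ?L i" using D[OF qa(1,2)] by auto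
    obtain l where l: "l < ?t" "delta A q a = ?L l" using D[OF _ qa(4)] qa by auto
    have "\<not> l \<le> i" using ord[of i a l] i l qa(3) t by (auto simp: min_absorb2)
    then show ?thesis using i l inj by simp
  qed
  then show "\<exists>pos :: nat \<Rightarrow> nat. \<forall>q a. q < n \<longrightarrow> q \<notin> D \<longrightarrow> a < b \<longrightarrow> delta A q a \<notin> D \<longrightarrow> pos q < pos (delta A q a)"
    by blast
qed

lemma tableD:
  assumes "table s" "q < n"
  shows "mem s Row q = q * b" "a < b \<Longrightarrow> mem s Trans (q * b + a) = delta A q a"
    and "mem s Trans (q * b) = delta A q 0" "mem s Trans (Suc (q * b)) = delta A q 1"
proof -
  have *: "mem s Trans (q * b + a) = delta A q a" if "a < b" for a
    using assms that unfolding table_def by blast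
  show "mem s Row q = q * b" "a < b \<Longrightarrow> mem s Trans (q * b + a) = delta A q a"
    using assms * by (auto simp: table_def)
  show "mem s Trans (q * b) = delta A q 0" "mem s Trans (Suc (q * b)) = delta A q 1"
    using *[of 0] *[of 1] base by simp_all
qed

text \<open>The invariant asks for some core preimage, not a particular one, so overwriting an entry
  preserves it. The bound by \<open>n\<close> holds initially because the entries are
  \<open>0\<close> and \<open>n > 0\<close>.\<close>

lemma invert_zero:
  assumes "constants s" "table s" "\<And>r. mem s Inv r = 0"
  defines "D \<equiv> {q. q < n \<and> mem s Deg q > 0}"
  defines "s' \<equiv> sem invert_zero s"
  shows "constants s'" "table s'" "\<And>x. x \<noteq> Inv \<Longrightarrow> mem s' x = mem s x"
    and "\<And>r. mem s' Inv r < n"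
    and "\<And>q. q \<in> D \<Longrightarrow> mem s' Inv (delta A q 0) \<in> D \<and> delta A (mem s' Inv (delta A q 0)) 0 = delta A q 0"
proof -
  let ?J = "\<lambda>k s'. constants s' \<and> (\<forall>x. x \<noteq> Inv \<longrightarrow> mem s' x = mem s x) \<and> (\<forall>r. mem s' Inv r < n) \<and>
    (\<forall>q<k. q \<in> D \<longrightarrow> mem s' Inv (delta A q 0) \<in> D \<and> delta A (mem s' Inv (delta A q 0)) 0 = delta A q 0)"
  have J: "?J (vars s VN) (sem invert_zero s)"
    unfolding invert_zero_def
  proof (rule For_invariant[where J = ?J], goal_cases)
    case (3 k t)
    then have k: "k < n" using assms(1) by (simp add: constants_def)
    then have t: "mem t Row k = k * b" "mem t Trans (k * b) = delta A k 0"
      using 3(2) tableD[OF assms(2)] by simp_all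
    have D: "k \<in> D \<longleftrightarrow> mem t Deg k > 0" using 3(2) k by (simp add: D_def)
    show ?case
    proof (cases "k \<in> D")
      case True
      then show ?thesis using 3(2,3) t D k by (simp add: constants_def less_Suc_eq)
    next
      case False
      then show ?thesis using 3(2,3) D by (simp add: constants_def less_Suc_eq)
    qed
  qed (use assms n_pos in \<open>simp_all add: constants_def\<close>)
  then show "constants s'" "table s'" "\<And>x. x \<noteq> Inv \<Longrightarrow> mem s' x = mem s x" "\<And>r. mem s' Inv r < n"
    "\<And>q. q \<in> D \<Longrightarrow> mem s' Inv (delta A q 0) \<in> D \<and> delta A (mem s' Inv (delta A q 0)) 0 = delta A q 0"
    using assms(1,2) unfolding s'_def table_def by (simp_all add: constants_def D_def)
qed

lemma compute_shift:
  assumes "constants s" "table s"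
  defines "s' \<equiv> sem compute_shift s"
  shows "constants s'" "table s'" "\<And>x. x \<noteq> Shift \<Longrightarrow> mem s' x = mem s x"
    and "\<And>q. q < n \<Longrightarrow> mem s' Shift q = mem s Inv (delta A q 1)"
proof -
  let ?J = "\<lambda>k s'. constants s' \<and> (\<forall>x. x \<noteq> Shift \<longrightarrow> mem s' x = mem s x) \<and>
    (\<forall>q<k. mem s' Shift q = mem s Inv (delta A q 1))"
  have J: "?J (vars s VN) (sem compute_shift s)"
    unfolding compute_shift_def
  proof (rule For_invariant[where J = ?J], goal_cases)
    case (3 k t)
    then have k: "k < n" using assms(1) by (simp add: constants_def)
    then have t: "mem t Row k = k * b" "mem t Trans (Suc (k * b)) = delta A k 1"
      using 3(2) tableD[OF assms(2)] by simp_all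
    show ?case using 3(2,3) t by (simp add: constants_def less_Suc_eq)
  qed (use assms in \<open>simp_all add: constants_def\<close>)
  then show "constants s'" "table s'" "\<And>x. x \<noteq> Shift \<Longrightarrow> mem s' x = mem s x"
    "\<And>q. q < n \<Longrightarrow> mem s' Shift q = mem s Inv (delta A q 1)"
    using assms(1,2) unfolding s'_def table_def by (simp_all add: constants_def)
qed

text \<open>The part of \<open>constants\<close> that survives the checks, during which
  \<open>VBad\<close> may grow.\<close>

definition sizes :: "env \<Rightarrow> bool" where
  "sizes s \<longleftrightarrow> vars s VB = b \<and> vars s VN = n \<and> vars s VOne = 1"

lemma sizes_vars [simp]: "v VB = vars s VB \<Longrightarrow> v VN = vars s VN \<Longrightarrow> v VOne = vars s VOne \<Longrightarrow> sizes (s\<lparr>vars := v\<rparr>) = sizes s"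
  by (simp add: sizes_def)

lemma compare:
  "vars (sem compare s) VBad = 0 \<longleftrightarrow> vars s VBad = 0 \<and> vars s VX = vars s VY"
  "mem (sem compare s) = mem s" "x \<notin> {VT, VY, VBad} \<Longrightarrow> vars (sem compare s) x = vars s x"
  by (auto simp: compare_def)

lemma check_row:
  assumes "sizes s" "table s" "vars s VR = q * b" "vars s VZ = delta A q 0" "vars s VS = g * b" "q < n" "g < n"
  defines "s' \<equiv> sem check_row s"
  shows "sizes s'" "mem s' = mem s"
    and "vars s' VBad = 0 \<longleftrightarrow> vars s VBad = 0 \<and>
      (\<forall>a<b. delta A g a = (if Suc a < b then delta A q (Suc a) else mem s Shift (delta A q 0)))"
proof -
  let ?eq = "\<lambda>a. delta A g a = (if Suc a < b then delta A q (Suc a) else mem s Shift (delta A q 0))"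
  let ?J = "\<lambda>k s'. sizes s' \<and> mem s' = mem s \<and> (\<forall>x\<in>{VR, VZ, VS}. vars s' x = vars s x) \<and>
    (vars s' VBad = 0 \<longleftrightarrow> vars s VBad = 0 \<and> (\<forall>a<k. ?eq a))"
  have "?J (vars s VB) (sem check_row s)"
    unfolding check_row_def
  proof (rule For_invariant[where J = ?J], goal_cases)
    case 1
    show ?case by (simp add: compare_def)
  next
    case 2
    show ?case using assms by simp
  next
    case (3 k t)
    then have k: "k < b" using assms(1) by (simp add: sizes_def)
    let ?u = "sem (AddC VX VS VA ;; Get VX Trans VX ;; AddC VH VA VOne ;; SubC VT VB VH ;;
     Cond VT (AddC VH VR VH ;; Get VY Trans VH) (Get VY Shift VZ)) t"
    have "mem s Trans (g * b + k) = delta A g k" using assms(2,7) k by (simp add: table_def)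
    moreover have "mem s Trans (Suc (q * b + k)) = delta A q (Suc k)" if "Suc k < b"
      using assms(2,6) that by (auto simp: table_def simp flip: add_Suc_right)
    ultimately have u: "vars ?u VX = vars ?u VY \<longleftrightarrow> ?eq k" "mem ?u = mem t"
      "\<And>x. x \<notin> {VX, VH, VT, VY} \<Longrightarrow> vars ?u x = vars t x"
      using 3 assms(3-5) by (auto simp: sizes_def)
    show ?case
      using 3(2) u compare[where s = ?u] by (simp add: sizes_def less_Suc_eq) blast
  qed
  then show "sizes s'" "mem s' = mem s" "vars s' VBad = 0 \<longleftrightarrow> vars s VBad = 0 \<and> (\<forall>a<b. ?eq a)"
    using assms(1) by (simp_all add: s'_def sizes_def)
qed

lemma check_zero:
  assumes "sizes s" "table s" "finals_bits s" "vars s VQ = q" "q < n"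
  defines "s' \<equiv> sem check_zero s"
  shows "sizes s'" "mem s' = mem s" "vars s' VR = q * b" "vars s' VZ = delta A q 0" "vars s' VQ = q"
    and "vars s' VBad = 0 \<longleftrightarrow> vars s VBad = 0 \<and> (delta A q 0 \<in> finals A \<longleftrightarrow> q \<in> finals A)"
proof -
  let ?u = "sem (Get VR Row VQ ;; Get VZ Trans VR ;; Get VX Final VQ ;; Get VY Final VZ) s"
  have s': "s' = sem compare ?u" by (simp add: s'_def check_zero_def)
  have u: "mem ?u = mem s" "vars ?u VR = q * b" "vars ?u VZ = delta A q 0"
     "\<And>x. x \<notin> {VX, VR, VZ, VY} \<Longrightarrow> vars ?u x = vars s x"
     "vars ?u VX = mem s Final q" "vars ?u VY = mem s Final (delta A q 0)"
    using assms(4) tableD[OF assms(2,5)] by simp_all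
  have "mem s Final q = mem s Final (delta A q 0) \<longleftrightarrow> (delta A q 0 \<in> finals A \<longleftrightarrow> q \<in> finals A)"
    using assms(3,5) base by (auto simp: finals_bits_def)
  then show "sizes s'" "mem s' = mem s" "vars s' VR = q * b" "vars s' VZ = delta A q 0" "vars s' VQ = q"
    "vars s' VBad = 0 \<longleftrightarrow> vars s VBad = 0 \<and> (delta A q 0 \<in> finals A \<longleftrightarrow> q \<in> finals A)"
    using assms(1,4) compare[where s = ?u] u unfolding s' by (simp_all add: sizes_def)
qed

lemma check_core:
  assumes "sizes s" "table s" "vars s VQ = q" "mem s Shift q = g" "g < n"
  defines "s' \<equiv> sem check_core s"
  shows "sizes s'" "mem s' = mem s" "vars s' VS = g * b" "vars s' VR = vars s VR" "vars s' VZ = vars s VZ"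
    and "vars s' VBad = 0 \<longleftrightarrow> vars s VBad = 0 \<and> mem s Deg g > 0"
  using assms(1,3,4) tableD[OF assms(2,5)] by (auto simp: s'_def check_core_def sizes_def)

text \<open>The bound on \<open>Shift\<close> keeps lookups in the row of \<open>Shift q\<close>
  inside the table, even after the test for the core has failed.\<close>

lemma check:
  assumes "sizes s" "table s" "finals_bits s" "vars s VBad = 0" "\<And>q. q < n \<Longrightarrow> mem s Shift q < n"
  defines "D \<equiv> {q. q < n \<and> mem s Deg q > 0}"
  shows "vars (sem check s) VBad = 0 \<longleftrightarrow> (\<forall>q<n. (delta A q 0 \<in> finals A \<longleftrightarrow> q \<in> finals A) \<and>
    (q \<in> D \<longrightarrow> mem s Shift q \<in> D \<and> (\<forall>a<b. delta A (mem s Shift q) a =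
      (if Suc a < b then delta A q (Suc a) else mem s Shift (delta A q 0)))))"
proof -
  define Z where "Z q \<longleftrightarrow> (delta A q 0 \<in> finals A \<longleftrightarrow> q \<in> finals A)" for q
  define E where "E q \<longleftrightarrow> (\<forall>a<b. delta A (mem s Shift q) a =
      (if Suc a < b then delta A q (Suc a) else mem s Shift (delta A q 0)))" for q
  define P where "P q \<longleftrightarrow> Z q \<and> (q \<in> D \<longrightarrow> mem s Shift q \<in> D \<and> E q)" for q
  let ?J = "\<lambda>k s'. sizes s' \<and> mem s' = mem s \<and> (vars s' VBad = 0 \<longleftrightarrow> (\<forall>q<k. P q))"
  have "?J (vars s VN) (sem check s)"
    unfolding check_def
  proof (rule For_invariant[where J = ?J], goal_cases)
    case 1
    show ?case by (simp add: check_row_def compare_def check_zero_def check_core_def)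
  next
    case 2
    show ?case using assms by simp
  next
    case (3 k t)
    then have k: "k < n" using assms(1) by (simp add: sizes_def)
    have t: "sizes t" "table t" "finals_bits t" "mem t = mem s"
      using 3(2) assms(2,3) by (simp_all add: table_def finals_bits_def)
    let ?u = "sem (Get VX Deg VQ) (sem check_zero t)"
    have u: "sizes ?u" "mem ?u = mem s" "vars ?u VR = k * b" "vars ?u VZ = delta A k 0" "vars ?u VQ = k"
      "vars ?u VX = mem s Deg k" "vars ?u VBad = 0 \<longleftrightarrow> vars t VBad = 0 \<and> Z k"
      using check_zero[OF t(1-3) 3(3) k] t(4) by (simp_all add: Z_def)
    have tu: "table ?u" using assms(2) u(2) by (simp add: table_def)
    have g: "mem s Shift k < n" using assms(5) k by simp
    let ?v = "sem check_core ?u"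
    have "mem ?u Shift k = mem s Shift k" using u(2) by simp
    note v = check_core[OF u(1) tu u(5) this g, unfolded u(2-4)]
    have tv: "table ?v" using assms(2) v(2) by (simp add: table_def)
    note w = check_row[OF v(1) tv v(4,5,3) k g, unfolded v(2), folded E_def]
    define W where "W = sem (check_zero ;; Get VX Deg VQ ;; Cond VX (check_core ;; check_row) Skip) t"
    have W: "W = (if k \<in> D then sem check_row ?v else ?u)"
      using u(6) k by (simp add: W_def D_def)
    have "sizes W" "mem W = mem s" unfolding W using w u(1,2) by simp_all
    moreover have "mem s Deg (mem s Shift k) > 0 \<longleftrightarrow> mem s Shift k \<in> D" using g by (simp add: D_def)
    then have "vars W VBad = 0 \<longleftrightarrow> vars t VBad = 0 \<and> P k"
      unfolding W P_def using w(3) v(6) u(7) by auto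
    then have "vars W VBad = 0 \<longleftrightarrow> (\<forall>q<Suc k. P q)" using 3(2) by (auto simp: less_Suc_eq)
    ultimately show ?case unfolding W_def[symmetric] by simp
  qed
  then show ?thesis using assms(1) by (simp add: sizes_def P_def Z_def E_def)
qed


text \<open>If some state violates \<open>zero\<close>, no set at all is accepted by value, and
  \<open>check\<close> fails as well. Otherwise the result of peeling is an instance of
  \<open>core\<close>, and \<open>periodic_iff_shift\<close> applies to the computed
  \<open>Shift\<close>.\<close>

lemma algorithm:
  assumes min: "minimal_dfa b n A"
    and s: "vars s = (\<lambda>_. 0)(VB := b, VN := n)" "mem s = (\<lambda>_ _. 0)"
      "input s = init A # concat (map (\<lambda>q. map (delta A q) [0..<b]) [0..<n])
        @ map (\<lambda>q. if q \<in> finals A then 1 else 0) [0..<n]"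
  shows "vars (sem algorithm s) VBad = 0 \<longleftrightarrow> (\<exists>S. ultimately_periodic S \<and> accepts_set b A S)"
proof -
  define s1 where "s1 = sem (ReadC VX ;; LetC VOne 1) s"
  have s1: "constants s1" "vars s1 VR = 0" "vars s1 VT = 0" "mem s1 = (\<lambda>_ _. 0)"
    "input s1 = concat (map (\<lambda>q. map (delta A q) [0..<b]) [0..<n])
        @ map (\<lambda>q. if q \<in> finals A then 1 else 0) [0..<n]"
    using s by (simp_all add: s1_def constants_def)
  define s2 where "s2 = sem load_table s1"
  have "mem s1 Deg r = 0" for r using s1(4) by simp
  note s2 = load_table[OF s1(1,2,5) this, folded s2_def]
  define s3 where "s3 = sem load_finals s2"
  note s3 = load_finals[OF s2(1,2,3), folded s3_def]
  define s4 where "s4 = sem seed_queue s3"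
  have "vars s3 VT = 0" using s3(4) s2(4) s1(3) by simp
  note s4 = seed_queue[OF s3(1,2) this, folded s4_def]
  define s5 where "s5 = sem peel s4"
  have "mem s4 Deg r = indeg b A {..<n} r" for r using s4(4) s3(5) s2(5) by simp
  note s5 = peel[OF s4(1-3) this, folded s5_def]
  define s6 where "s6 = sem invert_zero s5"
  have "mem s5 Inv r = 0" for r using s5(3) s4(4) s3(5) s2(6) s1(4) by simp
  note s6 = invert_zero[OF s5(1,2) this, folded s6_def]
  define s7 where "s7 = sem compute_shift s6"
  note s7 = compute_shift[OF s6(1,2), folded s7_def]
  define D where "D = {q. q < n \<and> mem s5 Deg q > 0}"
  have "mem s7 Deg = mem s5 Deg" using s7(3) s6(3) by simp
  then have D: "D = {q. q < n \<and> mem s7 Deg q > 0}" by (simp add: D_def)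
  define g where "g = mem s7 Shift"
  have g: "g q < n" if "q < n" for q using s7(4)[OF that] s6(4) by (simp add: g_def)
  have "mem s7 Final = mem s3 Final" using s7(3) s6(3) s5(3) s4(4) by simp
  then have "finals_bits s7" using s3(3) by (simp add: finals_bits_def)
  moreover have "sizes s7" "vars s7 VBad = 0" using s7(1) by (simp_all add: constants_def sizes_def)
  moreover have "\<And>q. q < n \<Longrightarrow> mem s7 Shift q < n" using g by (simp add: g_def)
  ultimately have bad: "vars (sem check s7) VBad = 0 \<longleftrightarrow> (\<forall>q<n. (delta A q 0 \<in> finals A \<longleftrightarrow> q \<in> finals A) \<and>
    (q \<in> D \<longrightarrow> g q \<in> D \<and> (\<forall>a<b. delta A (g q) a =
      (if Suc a < b then delta A q (Suc a) else g (delta A q 0)))))"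
    using check[of s7] s7(2) D by (simp add: g_def)
  have alg: "sem algorithm s = sem check s7"
    by (simp add: algorithm_def s7_def s6_def s5_def s4_def s3_def s2_def s1_def)
  obtain pos :: "nat \<Rightarrow> nat" where
    pos: "\<And>q a. q < n \<Longrightarrow> q \<notin> D \<Longrightarrow> a < b \<Longrightarrow> delta A q a \<notin> D \<Longrightarrow> pos q < pos (delta A q a)"
    using s5(6) unfolding D_def by blast
  show ?thesis
  proof (cases "\<forall>q<n. delta A q 0 \<in> finals A \<longleftrightarrow> q \<in> finals A")
    case False
    then have "\<not> value_dfa b n A" by (auto simp: value_dfa_def)
    then have "\<nexists>S. accepts_set b A S" using value_dfa_if_accepts_set[OF base min] by blast
    then show ?thesis using False unfolding alg bad by blast
  next
    case True
    interpret core b n A D pos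
    proof
      show "b > 1" "is_dfa b n A" by (fact base dfa)+
      show "\<And>q. q < n \<Longrightarrow> delta A q 0 \<in> finals A \<longleftrightarrow> q \<in> finals A" using True by blast
      show "\<And>q. q \<in> D \<Longrightarrow> q < n" by (simp add: D_def)
      show "\<And>q a. q \<in> D \<Longrightarrow> a < b \<Longrightarrow> delta A q a \<in> D" using s5(4) unfolding D_def .
      show "\<And>q. q \<in> D \<Longrightarrow> \<exists>p\<in>D. \<exists>a<b. delta A p a = q" using s5(5) unfolding D_def .
    qed (rule pos)
    have "g q \<in> D \<and> delta A (g q) 0 = delta A q 1"
      if q: "q \<in> D" and ex: "\<exists>p\<in>D. delta A p 0 = delta A q 1" for q
    proof -
      \<comment> \<open>Given a preimage \<open>p\<close>, the entry of \<open>Inv\<close> was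
        written by a core state, though not necessarily by \<open>p\<close>.\<close>
      obtain p where p: "p \<in> D" "delta A p 0 = delta A q 1" using ex by blast
      have "g q = mem s6 Inv (delta A q 1)" using s7(4) core_less[OF q] by (simp add: g_def)
      then show ?thesis using s6(5)[of p] p unfolding D_def by simp
    qed
    from periodic_iff_shift[OF min this]
    show ?thesis unfolding alg bad is_shift_def using True core_less by blast
  qed
qed

end

lemma answers_withinI:
  assumes "runs P t (0, \<lambda>_. 0, inp) (pc, X, inp')" "pc < length P" "P ! pc = Halt ans"
  shows "answers_within P inp t ans"
proof -
  obtain k where "k \<le> t" "(step P ^^ k) (0, \<lambda>_. 0, inp) = (pc, X, inp')"
    using assms(1) by (auto simp: runs_def)
  then show ?thesis
    unfolding answers_within_def using assms(2,3) by (intro exI[of _ k]) simp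
qed

text \<open>\<open>b\<close> and \<open>n\<close> are put in place before the compiled code starts,
  since they bound its loops. A positive \<open>VBad\<close> jumps to the negative answer.\<close>

definition program :: "instr list" where
  "program = [Read (reg VB), Read (reg VN)] @ comp 2 algorithm
     @ [Jump (reg VBad) (clen algorithm + 4), Halt True, Halt False]"

lemma program_correct:
  assumes b: "b > 1" and min: "minimal_dfa b n A"
  shows "answers_within program (encode b n A) (cost b n algorithm + 3)
    (\<exists>S. ultimately_periodic S \<and> accepts_set b A S)"
proof -
  have "is_dfa b n A" using min by (simp add: minimal_dfa_def)
  then interpret algorithm_run b n A using b by unfold_locales
  let ?c = "algorithm" and ?P = program
  define X where "X = (\<lambda>_. 0 :: nat)(reg VB := b, reg VN := n)"
  define s where "s = \<lparr>vars = (\<lambda>_. 0)(VB := b, VN := n), mem = \<lambda>_ _. 0,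
    input = init A # concat (map (\<lambda>q. map (delta A q) [0..<b]) [0..<n])
        @ map (\<lambda>q. if q \<in> finals A then 1 else 0) [0..<n]\<rparr>"
  have enc: "encode b n A = b # n # input s"
    by (simp add: encode_def s_def)
  have code: "code_at ?P 0 program" by (auto simp: code_at_def)
  then have P: "?P ! 0 = Read (reg VB)" "?P ! 1 = Read (reg VN)" "code_at ?P 2 (comp 2 ?c)"
    "?P ! (clen ?c + 2) = Jump (reg VBad) (clen ?c + 4)" "?P ! (clen ?c + 3) = Halt True" "?P ! (clen ?c + 4) = Halt False"
    "clen ?c + 4 < length ?P"
    by (auto simp: program_def nth_append numeral_eq_Suc code_at_Cons)
  have "?P \<noteq> []" by (simp add: program_def)
  then have "runs ?P 2 (0, \<lambda>_. 0, encode b n A) (2, X, input s)"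
    using P(1,2,7) by (intro runs_funpow) (simp add: step_def enc X_def numeral_eq_Suc)
  note start = this
  have "rep X s" by (simp add: rep_def X_def s_def)
  moreover have "implements b n ?c"
    by (intro implements_com) (simp_all add: algorithm_def program_defs)
  ultimately obtain X' where *: "runs ?P (cost b n ?c) (2, X, input s) (2 + clen ?c, X', input (sem ?c s))"
    "rep X' (sem ?c s)"
    using P(3) unfolding implements_def by (force simp: s_def)
  have X': "runs ?P (2 + cost b n ?c) (0, \<lambda>_. 0, encode b n A) (2 + clen ?c, X', input (sem ?c s))"
    "rep X' (sem ?c s)"
    using runs_trans[OF start *(1)] *(2) by simp_all
  let ?ans = "\<exists>S. ultimately_periodic S \<and> accepts_set b A S"
  have "vars (sem ?c s) VBad = 0 \<longleftrightarrow> ?ans" by (rule algorithm[OF min]) (simp_all add: s_def)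
  then have ans: "X' (reg VBad) = 0 \<longleftrightarrow> ?ans" using X'(2) by (simp add: rep_def)
  have "runs ?P 1 (2 + clen ?c, X', input (sem ?c s)) (if ?ans then clen ?c + 3 else clen ?c + 4, X', input (sem ?c s))"
    using P(4,7) ans by (intro runs_funpow) (auto simp: step_def)
  from runs_trans[OF X'(1) this] have "runs ?P (cost b n ?c + 3) (0, \<lambda>_. 0, encode b n A)
      (if ?ans then clen ?c + 3 else clen ?c + 4, X', input (sem ?c s))"
    by (rule runs_mono) simp
  then show ?thesis by (rule answers_withinI) (use P(5-7) in auto)
qed

text \<open>Loops are nested at most two deep, over states and then over letters;
  \<open>b * n\<close> dominates \<open>n\<close> and the constants.\<close>

lemma cost_algorithm:
  assumes "b > 0" "n > 0"
  shows "cost b n algorithm + 3 \<le> 400 * (b * n)"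
proof -
  have "cost b n algorithm + 3 \<le> 50 + 200 * n + 100 * (b * n)"
    by (simp add: algorithm_def program_defs algebra_simps)
  moreover have "n \<le> b * n" "1 \<le> b * n" using assms by simp_all
  ultimately show ?thesis by linarith
qed

theorem theorem1p1:
  "\<exists>(P :: instr list) (C :: nat). \<forall>(b :: nat) (n :: nat) (A :: dfa).
     b > 1 \<longrightarrow> minimal_dfa b n A \<longrightarrow>
       answers_within P (encode b n A) (C * (b * n))
         (\<exists>S :: nat set. ultimately_periodic S \<and> accepts_set b A S)"
proof (intro exI allI impI)
  fix b n :: nat and A :: dfa
  assume *: "b > 1" "minimal_dfa b n A"
  then have "n > 0" by (auto simp: minimal_dfa_def is_dfa_def)
  then have "cost b n algorithm + 3 \<le> 400 * (b * n)" using *(1) by (intro cost_algorithm) auto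
  then show "answers_within program (encode b n A) (400 * (b * n))
      (\<exists>S :: nat set. ultimately_periodic S \<and> accepts_set b A S)"
    using program_correct[OF *] unfolding answers_within_def by (meson order_trans)
qed
end
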